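(* Let $m,n\in\mathbb N$ and let $\ell$ be an integer with $0\leq \ell\leq m+n$. Then: (i) The $\mathcal H$-module $(L_m\otimes L_n)(m+n-2\ell)$ is irreducible of dimension $\min\{m,\ell\}+\min\{n,\ell\}-\ell+1$. (ii) Let $m',n'\in\mathbb N$ and let $\ell'$ be an integer with $0\leq \ell'\leq m'+n'$. Then the $\mathcal H$-module $(L_{m'}\otimes L_{n'})(m'+n'-2\ell')$ is isomorphic to $(L_m\otimes L_n)(m+n-2\ell)$ if and only if $$(m',n',\ell')\in\{(m,n,\ell),\ (m+n-\ell,\ell,n),\ (\ell,m+n-\ell,m),\ (n,m,m+n-\ell)\}.$$
   Context: All algebras are unital associative over $\mathbb C$; $[x,y]=xy-yx$. $U(\mathfrak{sl}_2)$ is the algebra generated by $E,F,H$ with relations $[H,E]=2E$, $[H,F]=-2F$, $[E,F]=H$; $\Lambda=EF+FE+\frac{H^2}{2}$; $\Delta:U(\mathfrak{sl}_2)\to U(\mathfrak{sl}_2)\otimes U(\mathfrak{sl}_2)$ is the algebra homomorphism with $\Delta(X)=X\otimes 1+1\otimes X$ for $X\in\{E,F,H\}$. For $n\in\mathbb N$, $L_n$ is the $(n+1)$-dimensional $U(\mathfrak{sl}_2)$-module with basis $v_0,\dots,v_n$ such that $Ev_i=iv_{i-1}$ ($1\le i\le n$), $Ev_0=0$, $Fv_i=(n-i)v_{i+1}$ ($0\le i\le n-1$), $Fv_n=0$, $Hv_i=(n-2i)v_i$. $L_m\otimes L_n$ is a $U(\mathfrak{sl}_2)\otimes U(\mathfrak{sl}_2)$-module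 via $(X\otimes Y)(v\otimes w)=Xv\otimes Yw$. The universal Hahn algebra $\mathcal H$ is the algebra generated by $A,B,C$ subject to $[A,B]=C$ and that each of $[C,A]+2A^2+B$ and $[B,C]+4BA+2C$ is central. Let $\natural:\mathcal H\to U(\mathfrak{sl}_2)\otimes U(\mathfrak{sl}_2)$ be the algebra homomorphism with $A\mapsto \frac{H\otimes1-1\otimes H}{4}$, $B\mapsto\frac{\Delta(\Lambda)}{2}$, $C\mapsto E\otimes F-F\otimes E$ (it exists). Every $U(\mathfrak{sl}_2)\otimes U(\mathfrak{sl}_2)$-module is regarded as an $\mathcal H$-module by pulling back via $\natural$. For a $U(\mathfrak{sl}_2)\otimes U(\mathfrak{sl}_2)$-module $V$ and $\theta\in\mathbb C$, $V(\theta)=\{v\in V:\Delta(H)v=\theta v\}$; this is an $\mathcal H$-submodule of $V$. *)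

theory Defs
  imports Complex_Main "HOL-Library.Poly_Mapping"
begin

section \<open>Complex vector spaces and unital associative complex algebras\<close>

class complex_vector = ab_group_add +
  fixes scaleC :: "complex \<Rightarrow> 'a \<Rightarrow> 'a" (infixr \<open>*\<^sub>C\<close> 75)
  assumes scaleC_add_right: "a *\<^sub>C (x + y) = a *\<^sub>C x + a *\<^sub>C y"
    and scaleC_add_left: "(a + b) *\<^sub>C x = a *\<^sub>C x + b *\<^sub>C x"
    and scaleC_scaleC: "a *\<^sub>C b *\<^sub>C x = (a * b) *\<^sub>C x"
    and scaleC_one: "1 *\<^sub>C x = x"

text \<open>Not based on \<open>ring_1\<close>, which excludes the zero algebra.\<close>

class complex_algebra_1 = complex_vector + ring + monoid_mult +
  assumes mult_scaleC_left: "(a *\<^sub>C x) * y = a *\<^sub>C (x * y)"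
    and mult_scaleC_right: "x * (a *\<^sub>C y) = a *\<^sub>C (x * y)"

global_interpretation cvec: vector_space "scaleC :: complex \<Rightarrow> 'a \<Rightarrow> 'a::complex_vector"
  defines csubspace = cvec.subspace
    and cspan = cvec.span
    and cdependent = cvec.dependent
    and cextend_basis = cvec.extend_basis
    and crepresentation = cvec.representation
    and cdim = cvec.dim
  by unfold_locales (simp_all add: scaleC_add_right scaleC_add_left scaleC_scaleC scaleC_one)

definition clinear :: "('a::complex_vector \<Rightarrow> 'b::complex_vector) \<Rightarrow> bool" where
  "clinear f \<longleftrightarrow> (\<forall>x y. f (x + y) = f x + f y) \<and> (\<forall>c x. f (c *\<^sub>C x) = c *\<^sub>C f x)"

definition algebra_hom :: "('a::complex_algebra_1 \<Rightarrow> 'b::complex_algebra_1) \<Rightarrow> bool" where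
  "algebra_hom f \<longleftrightarrow> clinear f \<and> f 1 = 1 \<and> (\<forall>x y. f (x * y) = f x * f y)"

definition commutator :: "'a::ring \<Rightarrow> 'a \<Rightarrow> 'a" (\<open>[_,/ _]\<^sub>c\<close>) where
  "[x, y]\<^sub>c = x * y - y * x"

lemma clinearI:
  "\<lbrakk>\<And>x y. f (x + y) = f x + f y; \<And>c x. f (c *\<^sub>C x) = c *\<^sub>C f x\<rbrakk> \<Longrightarrow> clinear f"
  by (simp add: clinear_def)

lemma clinear_add: "clinear f \<Longrightarrow> f (x + y) = f x + f y"
  and clinear_scale: "clinear f \<Longrightarrow> f (c *\<^sub>C x) = c *\<^sub>C f x"
  by (simp_all add: clinear_def)

lemma clinear_zero: "clinear f \<Longrightarrow> f 0 = 0"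
  by (metis add_cancel_right_left clinear_add)

lemma clinear_minus: "clinear f \<Longrightarrow> f (- x) = - f x"
  by (metis add.right_inverse clinear_add clinear_zero minus_unique)

lemma clinear_diff: "clinear f \<Longrightarrow> f (x - y) = f x - f y"
  by (metis clinear_add diff_add_cancel eq_diff_eq)

lemma clinear_sum: "clinear f \<Longrightarrow> f (sum g A) = (\<Sum>x\<in>A. f (g x))"
  by (induction A rule: infinite_finite_induct) (simp_all add: clinear_zero clinear_add)

lemma algebra_hom_clinear: "algebra_hom f \<Longrightarrow> clinear f"
  and algebra_hom_one: "algebra_hom f \<Longrightarrow> f 1 = 1"
  and algebra_hom_mult: "algebra_hom f \<Longrightarrow> f (x * y) = f x * f y"
  by (simp_all add: algebra_hom_def)

lemma algebra_hom_commutator: "algebra_hom f \<Longrightarrow> f [x, y]\<^sub>c = [f x, f y]\<^sub>c"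
  by (simp add: commutator_def algebra_hom_clinear clinear_diff algebra_hom_mult)

instantiation complex :: complex_algebra_1
begin
definition scaleC_complex :: "complex \<Rightarrow> complex \<Rightarrow> complex" where
  "scaleC_complex = (*)"
instance by standard (simp_all add: scaleC_complex_def algebra_simps)
end

instantiation poly_mapping :: (type, complex_vector) complex_vector
begin
lift_definition scaleC_poly_mapping :: "complex \<Rightarrow> ('a \<Rightarrow>\<^sub>0 'b) \<Rightarrow> ('a \<Rightarrow>\<^sub>0 'b)"
  is "\<lambda>c f k. c *\<^sub>C f k"
  by (erule rev_finite_subset) auto
instance
  by standard (transfer; simp add: scaleC_add_right scaleC_add_left scaleC_scaleC scaleC_one)+
end

lemma lookup_scaleC: "Poly_Mapping.lookup (c *\<^sub>C p) k = c *\<^sub>C Poly_Mapping.lookup p k"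
  by transfer simp

lemma scaleC_single: "c *\<^sub>C Poly_Mapping.single k x = Poly_Mapping.single k (c *\<^sub>C x)"
  by (rule poly_mapping_eqI) (simp add: lookup_scaleC lookup_single when_def)

definition lin_ext :: "('k \<Rightarrow> 'v::complex_vector) \<Rightarrow> ('k \<Rightarrow>\<^sub>0 complex) \<Rightarrow> 'v" where
  "lin_ext f p = (\<Sum>k\<in>Poly_Mapping.keys p. Poly_Mapping.lookup p k *\<^sub>C f k)"

lemma lin_ext_superset:
  assumes "finite S" "Poly_Mapping.keys p \<subseteq> S"
  shows "lin_ext f p = (\<Sum>k\<in>S. Poly_Mapping.lookup p k *\<^sub>C f k)"
  unfolding lin_ext_def
  by (rule sum.mono_neutral_left) (use assms in \<open>auto simp: in_keys_iff\<close>)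

lemma lin_ext_clinear: "clinear (lin_ext f)"
proof (rule clinearI)
  fix p q :: "'a \<Rightarrow>\<^sub>0 complex"
  let ?S = "Poly_Mapping.keys p \<union> Poly_Mapping.keys q"
  have "Poly_Mapping.keys (p + q) \<subseteq> ?S" by (rule keys_add)
  then show "lin_ext f (p + q) = lin_ext f p + lin_ext f q"
    by (simp add: lin_ext_superset[of ?S] lookup_add scaleC_add_left sum.distrib)
next
  fix c and p :: "'a \<Rightarrow>\<^sub>0 complex"
  have "Poly_Mapping.keys (c *\<^sub>C p) \<subseteq> Poly_Mapping.keys p"
    by (auto simp: in_keys_iff lookup_scaleC)
  then show "lin_ext f (c *\<^sub>C p) = c *\<^sub>C lin_ext f p"
    by (simp add: lin_ext_superset[of "Poly_Mapping.keys p"] lookup_scaleC scaleC_complex_def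
        scaleC_scaleC cvec.scale_sum_right)
qed

lemma lin_ext_single: "lin_ext f (Poly_Mapping.single k c) = c *\<^sub>C f k"
  by (simp add: lin_ext_def)

lemma pm_decomp: "p = (\<Sum>k\<in>Poly_Mapping.keys p. Poly_Mapping.lookup p k *\<^sub>C Poly_Mapping.single k 1)"
  for p :: "'k \<Rightarrow>\<^sub>0 complex"
proof (rule poly_mapping_eqI)
  fix k
  show "Poly_Mapping.lookup p k = Poly_Mapping.lookup (\<Sum>k\<in>Poly_Mapping.keys p. Poly_Mapping.lookup p k *\<^sub>C Poly_Mapping.single k 1) k"
    by (simp add: lookup_sum lookup_scaleC lookup_single scaleC_complex_def when_def
        if_distrib sum.delta in_keys_iff cong: if_cong)
qed

lemma clinear_pm_eqI:
  fixes f g :: "('k \<Rightarrow>\<^sub>0 complex) \<Rightarrow> 'v::complex_vector"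
  assumes "clinear f" "clinear g" "\<And>k. f (Poly_Mapping.single k 1) = g (Poly_Mapping.single k 1)"
  shows "f p = g p"
  by (subst (1 2) pm_decomp) (simp add: assms clinear_sum clinear_scale)

instance poly_mapping :: (monoid_add, "{ring_1, complex_algebra_1}") complex_algebra_1
proof
  fix a :: complex and x y :: "'a \<Rightarrow>\<^sub>0 'b"
  have s: "a *\<^sub>C z = Poly_Mapping.single 0 (a *\<^sub>C 1) * z"
    "a *\<^sub>C z = z * Poly_Mapping.single 0 (a *\<^sub>C 1)" for z :: "'a \<Rightarrow>\<^sub>0 'b"
  proof -
    have 1: "prod_fun (\<lambda>k. a *\<^sub>C 1 when k = 0) f = (\<lambda>k. a *\<^sub>C f k)" for f :: "'a \<Rightarrow> 'b" and a
      by (simp add: fun_eq_iff prod_fun_def when_mult mult_scaleC_left)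
    have 2: "prod_fun f (\<lambda>k. a *\<^sub>C 1 when k = 0) = (\<lambda>k. a *\<^sub>C f k)" for f :: "'a \<Rightarrow> 'b" and a
    proof
      fix k :: 'a
      have "(\<Sum>q. ((a *\<^sub>C 1 when q = 0) when k = l + q)) = (a *\<^sub>C (1::'b) when k = l)" for l
        by (subst when_commute) simp
      then show "prod_fun f (\<lambda>k. a *\<^sub>C 1 when k = 0) k = a *\<^sub>C f k"
        by (simp add: prod_fun_def mult_when mult_scaleC_right)
    qed
    show "a *\<^sub>C z = Poly_Mapping.single 0 (a *\<^sub>C 1) * z"
      by transfer (simp add: 1 eq_commute[of 0])
    show "a *\<^sub>C z = z * Poly_Mapping.single 0 (a *\<^sub>C 1)"
      by transfer (simp add: 2 eq_commute[of 0])
  qed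
  show "(a *\<^sub>C x) * y = a *\<^sub>C (x * y)" by (simp add: s(1) mult.assoc)
  show "x * (a *\<^sub>C y) = a *\<^sub>C (x * y)" by (metis s mult.assoc)
qed


section \<open>Algebras presented by generators and relations\<close>

text \<open>The free algebra on a type of generators is the monoid algebra of the free monoid. Poly-mappings
  form monoid algebras over additively written monoids, so concatenation is written as addition.\<close>

datatype 'g fmon = Word (letters: "'g list")

instantiation fmon :: (type) monoid_add
begin
definition zero_fmon :: "'a fmon" where "zero_fmon = Word []"
definition plus_fmon :: "'a fmon \<Rightarrow> 'a fmon \<Rightarrow> 'a fmon" where
  "plus_fmon u v = Word (letters u @ letters v)"
instance by standard (simp_all add: zero_fmon_def plus_fmon_def)
end

type_synonym 'g free_alg = "'g fmon \<Rightarrow>\<^sub>0 complex"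

definition fgen :: "'g \<Rightarrow> 'g free_alg" where
  "fgen g = Poly_Mapping.single (Word [g]) 1"

definition free_eval :: "('g \<Rightarrow> 'b::complex_algebra_1) \<Rightarrow> 'g free_alg \<Rightarrow> 'b" where
  "free_eval f = lin_ext (\<lambda>w. prod_list (map f (letters w)))"

inductive_set ideal_gen :: "'a::{ring, monoid_mult} set \<Rightarrow> 'a set" for R where
  base: "r \<in> R \<Longrightarrow> r \<in> ideal_gen R"
| zero: "0 \<in> ideal_gen R"
| add: "x \<in> ideal_gen R \<Longrightarrow> y \<in> ideal_gen R \<Longrightarrow> x + y \<in> ideal_gen R"
| mult: "x \<in> ideal_gen R \<Longrightarrow> a * x * b \<in> ideal_gen R"

lemma ideal_gen_left: "x \<in> ideal_gen R \<Longrightarrow> a * x \<in> ideal_gen R"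
  using ideal_gen.mult[of x R a 1] by simp

lemma ideal_gen_right: "x \<in> ideal_gen R \<Longrightarrow> x * a \<in> ideal_gen R"
  using ideal_gen.mult[of x R 1 a] by simp

lemma ideal_gen_minus: "x \<in> ideal_gen R \<Longrightarrow> - x \<in> ideal_gen R"
  using ideal_gen_left[of x R "- 1"] by (simp only: mult_minus_left mult_1_left)

lemma ideal_gen_scaleC: "x \<in> ideal_gen R \<Longrightarrow> c *\<^sub>C x \<in> ideal_gen R"
  for x :: "'a::complex_algebra_1"
  using ideal_gen_left[of x R "c *\<^sub>C 1"] by (simp add: mult_scaleC_left)

lemma free_eval_hom: "algebra_hom (free_eval f)"
  unfolding algebra_hom_def
proof (intro conjI allI)
  show l: "clinear (free_eval f)" by (simp add: free_eval_def lin_ext_clinear)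
  show "free_eval f 1 = 1"
    by (simp add: free_eval_def lin_ext_single scaleC_one zero_fmon_def flip: single_one)
  fix x y :: "'a free_alg"
  have l1: "clinear (\<lambda>x. free_eval f (x * y))" "clinear (\<lambda>x. free_eval f x * free_eval f y)" for y
    using l by (auto simp: clinear_def algebra_simps mult_scaleC_left)
  have l2: "clinear (\<lambda>y. free_eval f (x * y))" "clinear (\<lambda>y. free_eval f x * free_eval f y)" for x
    using l by (auto simp: clinear_def algebra_simps mult_scaleC_right)
  show "free_eval f (x * y) = free_eval f x * free_eval f y"
    by (rule clinear_pm_eqI[OF l1], rule clinear_pm_eqI[OF l2])
      (simp add: mult_single free_eval_def lin_ext_single scaleC_one plus_fmon_def)
qed

lemma free_eval_gen: "free_eval f (fgen g) = f g"
  by (simp add: free_eval_def fgen_def lin_ext_single scaleC_one)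

text \<open>A type of generators of class \<open>presentation\<close> carries the set of elements of the free algebra
  to be set to zero.\<close>

class presentation =
  fixes relators :: "('a fmon \<Rightarrow>\<^sub>0 complex) set"

definition pres_rel :: "'g::presentation free_alg \<Rightarrow> 'g free_alg \<Rightarrow> bool" where
  "pres_rel x y \<longleftrightarrow> x - y \<in> ideal_gen relators"

lemma pres_rel_trans:
  assumes "pres_rel x y" "pres_rel y z" shows "pres_rel x z"
  using ideal_gen.add[OF assms[unfolded pres_rel_def]] by (simp add: pres_rel_def)

lemma pres_rel_sym: "pres_rel x y \<Longrightarrow> pres_rel y x"
  using ideal_gen_minus[of "x - y"] by (simp add: pres_rel_def)

quotient_type (overloaded) 'g presented = "'g::presentation fmon \<Rightarrow>\<^sub>0 complex" / pres_rel
proof (rule equivpI)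
  show "reflp (pres_rel :: 'g free_alg \<Rightarrow> _)"
    by (simp add: reflp_def pres_rel_def ideal_gen.zero)
  show "symp (pres_rel :: 'g free_alg \<Rightarrow> _)"
    by (rule sympI) (rule pres_rel_sym)
  show "transp (pres_rel :: 'g free_alg \<Rightarrow> _)"
    by (rule transpI) (rule pres_rel_trans)
qed

instantiation presented :: (presentation) complex_algebra_1
begin
lift_definition zero_presented :: "'a presented" is 0 .
lift_definition one_presented :: "'a presented" is 1 .
lift_definition plus_presented :: "'a presented \<Rightarrow> 'a presented \<Rightarrow> 'a presented" is "(+)"
  unfolding pres_rel_def by (metis add_diff_add ideal_gen.add)
lift_definition uminus_presented :: "'a presented \<Rightarrow> 'a presented" is uminus
  unfolding pres_rel_def using ideal_gen_minus by (metis minus_diff_minus)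
lift_definition minus_presented :: "'a presented \<Rightarrow> 'a presented \<Rightarrow> 'a presented" is "(-)"
  unfolding pres_rel_def using ideal_gen.add ideal_gen_minus
  by (metis (no_types, lifting) add_diff_add diff_conv_add_uminus minus_diff_minus)
lift_definition times_presented :: "'a presented \<Rightarrow> 'a presented \<Rightarrow> 'a presented" is "(*)"
proof -
  fix x x' y y' :: "'a free_alg"
  assume "pres_rel x x'" "pres_rel y y'"
  then have "(x - x') * y + x' * (y - y') \<in> ideal_gen relators"
    unfolding pres_rel_def by (intro ideal_gen.add ideal_gen_left ideal_gen_right)
  then show "pres_rel (x * y) (x' * y')" by (simp add: pres_rel_def algebra_simps)
qed
lift_definition scaleC_presented :: "complex \<Rightarrow> 'a presented \<Rightarrow> 'a presented" is "(*\<^sub>C)"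
  unfolding pres_rel_def by (metis cvec.scale_right_diff_distrib ideal_gen_scaleC)
instance
proof
  fix a b c :: "'a presented" and r s :: complex
  note refl = equivp_reflp[OF presented_equivp]
  show "a + b + c = a + (b + c)" "a + b = b + a" "0 + a = a" "- a + a = 0" "a - b = a + - b"
    "a * b * c = a * (b * c)" "1 * a = a" "a * 1 = a"
    "(a + b) * c = a * c + b * c" "a * (b + c) = a * b + a * c"
    "r *\<^sub>C (a + b) = r *\<^sub>C a + r *\<^sub>C b" "(r + s) *\<^sub>C a = r *\<^sub>C a + s *\<^sub>C a"
    "r *\<^sub>C s *\<^sub>C a = (r * s) *\<^sub>C a" "1 *\<^sub>C a = a"
    "r *\<^sub>C a * b = r *\<^sub>C (a * b)" "a * r *\<^sub>C b = r *\<^sub>C (a * b)"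
    by (transfer; simp add: refl algebra_simps scaleC_add_right scaleC_add_left scaleC_scaleC
        scaleC_one mult_scaleC_left mult_scaleC_right)+
qed
end

lift_definition pgen :: "'g::presentation \<Rightarrow> 'g presented" is fgen .

text \<open>The algebra homomorphism out of a presented algebra with prescribed values on the generators;
  meaningful if \<open>f\<close> respects the relations, in which case the choice of representative is
  immaterial.\<close>

definition pres_lift :: "('g::presentation \<Rightarrow> 'b::complex_algebra_1) \<Rightarrow> 'g presented \<Rightarrow> 'b" where
  "pres_lift f x = free_eval f (rep_presented x)"

lemma pres_lift_abs:
  assumes "\<And>r. r \<in> relators \<Longrightarrow> free_eval f r = 0"
  shows "pres_lift f (abs_presented p) = free_eval f p"
proof -
  note h = free_eval_hom[of f] and l = algebra_hom_clinear[OF free_eval_hom[of f]]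
  have "free_eval f r = 0" if "r \<in> ideal_gen relators" for r
    using that
    by induction (simp_all add: assms clinear_zero[OF l] clinear_add[OF l] algebra_hom_mult[OF h])
  moreover have "pres_rel (rep_presented (abs_presented p)) p"
    using Quotient3_rep_abs[OF Quotient3_presented] equivp_reflp[OF presented_equivp] by metis
  ultimately show ?thesis
    by (metis clinear_diff[OF l] eq_iff_diff_eq_0 pres_lift_def pres_rel_def)
qed

lemma pres_lift_hom:
  assumes "\<And>r. r \<in> relators \<Longrightarrow> free_eval f r = 0"
  shows "algebra_hom (pres_lift f)" and "pres_lift f (pgen g) = f g"
proof -
  note h = free_eval_hom[of f] and l = algebra_hom_clinear[OF free_eval_hom[of f]]
  note ab = pres_lift_abs[OF assms]
  show "pres_lift f (pgen g) = f g"
    unfolding pgen.abs_eq using ab free_eval_gen by metis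
  have *: "\<exists>p. x = abs_presented p" for x :: "'a presented"
    by (metis Quotient3_abs_rep[OF Quotient3_presented])
  have "pres_lift f (x + y) = pres_lift f x + pres_lift f y"
    "pres_lift f (x * y) = pres_lift f x * pres_lift f y"
    "pres_lift f (c *\<^sub>C x) = c *\<^sub>C pres_lift f x" for x y c
    using *[of x] *[of y]
    by (auto simp: ab plus_presented.abs_eq times_presented.abs_eq scaleC_presented.abs_eq
        clinear_add[OF l] clinear_scale[OF l] algebra_hom_mult[OF h])
  moreover have "pres_lift f 1 = 1"
    by (simp add: one_presented.abs_eq ab algebra_hom_one[OF h])
  ultimately show "algebra_hom (pres_lift f)"
    by (simp add: algebra_hom_def clinear_def)
qed

lemma presented_relator:
  assumes "r \<in> relators" shows "free_eval pgen r = 0"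
proof -
  have *: "algebra_hom (abs_presented :: 'a::presentation free_alg \<Rightarrow> _)"
    by (simp add: algebra_hom_def clinear_def plus_presented.abs_eq times_presented.abs_eq
        scaleC_presented.abs_eq one_presented.abs_eq)
  note l = algebra_hom_clinear[OF *]
  have "abs_presented (Poly_Mapping.single (Word w) 1) = free_eval pgen (Poly_Mapping.single (Word w) 1)"
    for w :: "'a list"
  proof (induction w)
    case Nil
    show ?case
      using algebra_hom_one[OF *] algebra_hom_one[OF free_eval_hom[of "pgen::'a\<Rightarrow>_"]]
      by (simp add: zero_fmon_def flip: single_one)
  next
    case (Cons g w)
    have "Poly_Mapping.single (Word (g # w)) 1 = fgen g * Poly_Mapping.single (Word w) 1"
      by (simp add: fgen_def mult_single plus_fmon_def)
    with Cons show ?case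
      by (simp only: algebra_hom_mult[OF *] algebra_hom_mult[OF free_eval_hom] free_eval_gen
          pgen.abs_eq)
  qed
  then have "abs_presented (Poly_Mapping.single k 1) = free_eval pgen (Poly_Mapping.single k 1)"
    for k :: "'a fmon"
    by (cases k) simp
  then have "abs_presented p = free_eval pgen p" for p :: "'a free_alg"
    by (rule clinear_pm_eqI[OF l algebra_hom_clinear[OF free_eval_hom]])
  moreover have "abs_presented r = 0"
    using assms by (simp add: zero_presented_def presented.abs_eq_iff pres_rel_def ideal_gen.base)
  ultimately show ?thesis by simp
qed


section \<open>Tensor products\<close>

text \<open>The tensor product over the complex numbers is the vector space with basis the pairs
  \<open>Pt a b\<close>, modulo the span of the bilinearity relations. For algebras the pairs form a monoid under
  componentwise multiplication, again written additively to obtain the monoid algebra.\<close>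

datatype ('a, 'b) pt = Pt (pfst: 'a) (psnd: 'b)

instantiation pt :: (monoid_mult, monoid_mult) monoid_add
begin
definition zero_pt :: "('a, 'b) pt" where "zero_pt = Pt 1 1"
definition plus_pt :: "('a, 'b) pt \<Rightarrow> ('a, 'b) pt \<Rightarrow> ('a, 'b) pt" where
  "plus_pt p q = Pt (pfst p * pfst q) (psnd p * psnd q)"
instance by standard (simp_all add: zero_pt_def plus_pt_def mult.assoc)
end

definition ptens :: "'a \<Rightarrow> 'b \<Rightarrow> ('a, 'b) pt \<Rightarrow>\<^sub>0 complex" where
  "ptens a b = Poly_Mapping.single (Pt a b) 1"

inductive_set bilin_relators :: "(('a::complex_vector, 'b::complex_vector) pt \<Rightarrow>\<^sub>0 complex) set" where
  add_left: "ptens (a + a') b - (ptens a b + ptens a' b) \<in> bilin_relators"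
| add_right: "ptens a (b + b') - (ptens a b + ptens a b') \<in> bilin_relators"
| scale_left: "ptens (c *\<^sub>C a) b - c *\<^sub>C ptens a b \<in> bilin_relators"
| scale_right: "ptens a (c *\<^sub>C b) - c *\<^sub>C ptens a b \<in> bilin_relators"

definition tensor_rel ::
  "(('a::complex_vector, 'b::complex_vector) pt \<Rightarrow>\<^sub>0 complex) \<Rightarrow> (('a, 'b) pt \<Rightarrow>\<^sub>0 complex) \<Rightarrow> bool" where
  "tensor_rel x y \<longleftrightarrow> x - y \<in> cspan bilin_relators"

quotient_type (overloaded) ('a, 'b) tensor =
  "('a::complex_vector, 'b::complex_vector) pt \<Rightarrow>\<^sub>0 complex" / tensor_rel
proof (rule equivpI)
  show "reflp (tensor_rel :: (('a, 'b) pt \<Rightarrow>\<^sub>0 complex) \<Rightarrow> _)"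
    by (simp add: reflp_def tensor_rel_def cvec.span_zero)
  show "symp (tensor_rel :: (('a, 'b) pt \<Rightarrow>\<^sub>0 complex) \<Rightarrow> _)"
    unfolding symp_def tensor_rel_def by (metis cvec.span_neg minus_diff_eq)
  show "transp (tensor_rel :: (('a, 'b) pt \<Rightarrow>\<^sub>0 complex) \<Rightarrow> _)"
  proof (rule transpI)
    fix x y z :: "('a, 'b) pt \<Rightarrow>\<^sub>0 complex"
    assume "tensor_rel x y" "tensor_rel y z"
    then have "(x - y) + (y - z) \<in> cspan bilin_relators"
      unfolding tensor_rel_def by (rule cvec.span_add)
    then show "tensor_rel x z" by (simp add: tensor_rel_def)
  qed
qed

instantiation tensor :: (complex_vector, complex_vector) complex_vector
begin
lift_definition zero_tensor :: "('a, 'b) tensor" is 0 .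
lift_definition plus_tensor :: "('a, 'b) tensor \<Rightarrow> ('a, 'b) tensor \<Rightarrow> ('a, 'b) tensor" is "(+)"
  unfolding tensor_rel_def by (metis add_diff_add cvec.span_add)
lift_definition uminus_tensor :: "('a, 'b) tensor \<Rightarrow> ('a, 'b) tensor" is uminus
  unfolding tensor_rel_def by (metis minus_diff_minus cvec.span_neg)
lift_definition minus_tensor :: "('a, 'b) tensor \<Rightarrow> ('a, 'b) tensor \<Rightarrow> ('a, 'b) tensor" is "(-)"
proof -
  fix x x' y y' :: "('a, 'b) pt \<Rightarrow>\<^sub>0 complex"
  assume "tensor_rel x x'" "tensor_rel y y'"
  then have "(x - x') - (y - y') \<in> cspan bilin_relators"
    unfolding tensor_rel_def by (rule cvec.span_diff)
  then show "tensor_rel (x - y) (x' - y')" by (simp add: tensor_rel_def algebra_simps)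
qed
lift_definition scaleC_tensor :: "complex \<Rightarrow> ('a, 'b) tensor \<Rightarrow> ('a, 'b) tensor" is "(*\<^sub>C)"
  unfolding tensor_rel_def by (metis cvec.scale_right_diff_distrib cvec.span_scale)
instance
proof
  fix a b c :: "('a, 'b) tensor" and r s :: complex
  note refl = equivp_reflp[OF tensor_equivp]
  show "a + b + c = a + (b + c)" "a + b = b + a" "0 + a = a" "- a + a = 0" "a - b = a + - b"
    "r *\<^sub>C (a + b) = r *\<^sub>C a + r *\<^sub>C b" "(r + s) *\<^sub>C a = r *\<^sub>C a + s *\<^sub>C a"
    "r *\<^sub>C s *\<^sub>C a = (r * s) *\<^sub>C a" "1 *\<^sub>C a = a"
    by (transfer; simp add: refl algebra_simps scaleC_add_right scaleC_add_left scaleC_scaleC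
        scaleC_one)+
qed
end

lift_definition tensor_of :: "'a::complex_vector \<Rightarrow> 'b::complex_vector \<Rightarrow> ('a, 'b) tensor"
  (infixr \<open>\<otimes>\<close> 76) is ptens .

lemma ptens_mult: "ptens a b * ptens c d = ptens (a * c) (b * d)"
  by (simp add: ptens_def mult_single plus_pt_def)

lemma bilin_relators_ptens_mult:
  fixes a :: "'a::complex_algebra_1" and b :: "'b::complex_algebra_1"
  assumes "r \<in> bilin_relators"
  shows "ptens a b * r \<in> bilin_relators" and "r * ptens a b \<in> bilin_relators"
  using assms
  by (induction)
    (simp_all only: right_diff_distrib left_diff_distrib distrib_left distrib_right ptens_mult
      mult_scaleC_left mult_scaleC_right bilin_relators.intros)

lemma cspan_bilin_mult:
  fixes x p :: "('a::complex_algebra_1, 'b::complex_algebra_1) pt \<Rightarrow>\<^sub>0 complex"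
  assumes "x \<in> cspan bilin_relators"
  shows "p * x \<in> cspan bilin_relators" and "x * p \<in> cspan bilin_relators"
proof -
  have s: "Poly_Mapping.single k 1 = ptens (pfst k) (psnd k)" for k :: "('a, 'b) pt"
    by (simp add: ptens_def)
  have "ptens a b * x \<in> cspan bilin_relators \<and> x * ptens a b \<in> cspan bilin_relators" for a b
    using assms
    by (induction rule: cvec.span_induct_alt)
      (simp_all add: cvec.span_zero distrib_left distrib_right mult_scaleC_left mult_scaleC_right
        cvec.span_add cvec.span_scale cvec.span_base bilin_relators_ptens_mult)
  note e = this
  show "p * x \<in> cspan bilin_relators"
    by (subst pm_decomp[of p]) (simp add: s sum_distrib_right mult_scaleC_left cvec.span_sum
        cvec.span_scale e)
  show "x * p \<in> cspan bilin_relators"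
    by (subst pm_decomp[of p]) (simp add: s sum_distrib_left mult_scaleC_right cvec.span_sum
        cvec.span_scale e)
qed

instantiation tensor :: (complex_algebra_1, complex_algebra_1) complex_algebra_1
begin
lift_definition one_tensor :: "('a, 'b) tensor" is 1 .
lift_definition times_tensor :: "('a, 'b) tensor \<Rightarrow> ('a, 'b) tensor \<Rightarrow> ('a, 'b) tensor" is "(*)"
proof -
  fix x x' y y' :: "('a, 'b) pt \<Rightarrow>\<^sub>0 complex"
  assume "tensor_rel x x'" "tensor_rel y y'"
  then have "(x - x') * y + x' * (y - y') \<in> cspan bilin_relators"
    unfolding tensor_rel_def by (intro cvec.span_add cspan_bilin_mult)
  then show "tensor_rel (x * y) (x' * y')" by (simp add: tensor_rel_def algebra_simps)
qed
instance
proof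
  fix a b c :: "('a, 'b) tensor" and r :: complex
  note refl = equivp_reflp[OF tensor_equivp]
  show "a * b * c = a * (b * c)" "1 * a = a" "a * 1 = a"
    "(a + b) * c = a * c + b * c" "a * (b + c) = a * b + a * c"
    "r *\<^sub>C a * b = r *\<^sub>C (a * b)" "a * r *\<^sub>C b = r *\<^sub>C (a * b)"
    by (transfer; simp add: refl algebra_simps mult_scaleC_left mult_scaleC_right)+
qed
end

lemma tensor_mult: "(a \<otimes> b) * (c \<otimes> d) = (a * c) \<otimes> (b * d)"
  by (simp add: tensor_of.abs_eq times_tensor.abs_eq ptens_mult)

lemma tensor_one: "1 \<otimes> 1 = 1"
  by (simp add: tensor_of.abs_eq one_tensor.abs_eq ptens_def zero_pt_def flip: single_one)

definition cbilinear :: "('a::complex_vector \<Rightarrow> 'b::complex_vector \<Rightarrow> 'c::complex_vector) \<Rightarrow> bool" where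
  "cbilinear f \<longleftrightarrow> (\<forall>a. clinear (f a)) \<and> (\<forall>b. clinear (\<lambda>a. f a b))"

text \<open>The linear map out of a tensor product induced by a bilinear map; for bilinear \<open>f\<close> the choice
  of representative is immaterial.\<close>

definition tensor_lift ::
  "('a::complex_vector \<Rightarrow> 'b::complex_vector \<Rightarrow> 'c::complex_vector) \<Rightarrow> ('a, 'b) tensor \<Rightarrow> 'c" where
  "tensor_lift f t = lin_ext (\<lambda>k. f (pfst k) (psnd k)) (rep_tensor t)"

lemma tensor_of_bilinear: "cbilinear (\<otimes>)"
proof -
  note [simp] = tensor_of.abs_eq plus_tensor.abs_eq scaleC_tensor.abs_eq tensor.abs_eq_iff tensor_rel_def
  have "ptens (a + a') b - (ptens a b + ptens a' b) \<in> cspan bilin_relators"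
    "ptens a (b + b') - (ptens a b + ptens a b') \<in> cspan bilin_relators"
    "ptens (c *\<^sub>C a) b - c *\<^sub>C ptens a b \<in> cspan bilin_relators"
    "ptens a (c *\<^sub>C b) - c *\<^sub>C ptens a b \<in> cspan bilin_relators"
    for a a' :: 'a and b b' :: 'b and c
    by (simp_all add: cvec.span_base bilin_relators.intros)
  then show ?thesis by (simp add: cbilinear_def clinear_def)
qed

lemma tensor_lift_bilinear:
  assumes "cbilinear f"
  shows "clinear (tensor_lift f)" and "tensor_lift f (a \<otimes> b) = f a b"
proof -
  let ?g = "lin_ext (\<lambda>k. f (pfst k) (psnd k))"
  note l = lin_ext_clinear[of "\<lambda>k. f (pfst k) (psnd k)"]
  have b: "clinear (f a)" "clinear (\<lambda>a. f a b)" for a b using assms by (auto simp: cbilinear_def)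
  have p: "?g (ptens a b) = f a b" for a b by (simp add: ptens_def lin_ext_single scaleC_one)
  have "?g r = 0" if "r \<in> bilin_relators" for r
    using that
    by induction (simp_all add: clinear_diff[OF l] clinear_add[OF l] clinear_scale[OF l] p clinear_add[OF b(1)]
        clinear_add[OF b(2)] clinear_scale[OF b(1)] clinear_scale[OF b(2)])
  note r0 = this
  have z: "?g r = 0" if "r \<in> cspan bilin_relators" for r
    using that by (induction rule: cvec.span_induct_alt)
      (simp_all add: r0 clinear_zero[OF l] clinear_add[OF l] clinear_scale[OF l])
  have ab: "tensor_lift f (abs_tensor x) = ?g x" for x
  proof -
    have "tensor_rel (rep_tensor (abs_tensor x)) x"
      using Quotient3_rep_abs[OF Quotient3_tensor] equivp_reflp[OF tensor_equivp] by metis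
    then have "?g (rep_tensor (abs_tensor x) - x) = 0" by (simp add: tensor_rel_def z)
    then show ?thesis by (simp add: clinear_diff[OF l] tensor_lift_def)
  qed
  have *: "\<exists>p. x = abs_tensor p" for x :: "('a, 'b) tensor"
    by (metis Quotient3_abs_rep[OF Quotient3_tensor])
  have "tensor_lift f (x + y) = tensor_lift f x + tensor_lift f y"
    "tensor_lift f (c *\<^sub>C x) = c *\<^sub>C tensor_lift f x" for x y c
    using *[of x] *[of y]
    by (auto simp: ab plus_tensor.abs_eq scaleC_tensor.abs_eq clinear_add[OF l] clinear_scale[OF l])
  then show "clinear (tensor_lift f)" by (simp add: clinear_def)
  show "tensor_lift f (a \<otimes> b) = f a b" by (simp add: tensor_of.abs_eq ab p)
qed


section \<open>Modules\<close>

text \<open>A module over an algebra is given by a carrier \<open>V\<close> inside an ambient vector space and an action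
  of which only the restriction to \<open>V\<close> matters.\<close>

definition module_on ::
  "('a::complex_algebra_1 \<Rightarrow> 'v::complex_vector \<Rightarrow> 'v) \<Rightarrow> 'v set \<Rightarrow> bool" where
  "module_on act V \<longleftrightarrow> csubspace V \<and>
     (\<forall>x. \<forall>v\<in>V. act x v \<in> V) \<and>
     (\<forall>x. \<forall>v\<in>V. \<forall>w\<in>V. act x (v + w) = act x v + act x w) \<and>
     (\<forall>x c. \<forall>v\<in>V. act x (c *\<^sub>C v) = c *\<^sub>C act x v) \<and>
     (\<forall>x y. \<forall>v\<in>V. act (x + y) v = act x v + act y v) \<and>
     (\<forall>x c. \<forall>v\<in>V. act (c *\<^sub>C x) v = c *\<^sub>C act x v) \<and>
     (\<forall>v\<in>V. act 1 v = v) \<and>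
     (\<forall>x y. \<forall>v\<in>V. act (x * y) v = act x (act y v))"

definition irreducible_module ::
  "('a::complex_algebra_1 \<Rightarrow> 'v::complex_vector \<Rightarrow> 'v) \<Rightarrow> 'v set \<Rightarrow> bool" where
  "irreducible_module act V \<longleftrightarrow> module_on act V \<and> V \<noteq> {0} \<and>
     (\<forall>W. W \<subseteq> V \<and> module_on act W \<longrightarrow> W = {0} \<or> W = V)"

definition isomorphic_modules ::
  "('a::complex_algebra_1 \<Rightarrow> 'v::complex_vector \<Rightarrow> 'v) \<Rightarrow> 'v set \<Rightarrow>
   ('a \<Rightarrow> 'w::complex_vector \<Rightarrow> 'w) \<Rightarrow> 'w set \<Rightarrow> bool" where
  "isomorphic_modules act V act' V' \<longleftrightarrow> (\<exists>\<phi>. bij_betw \<phi> V V' \<and>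
     (\<forall>v\<in>V. \<forall>w\<in>V. \<phi> (v + w) = \<phi> v + \<phi> w) \<and>
     (\<forall>c. \<forall>v\<in>V. \<phi> (c *\<^sub>C v) = c *\<^sub>C \<phi> v) \<and>
     (\<forall>x. \<forall>v\<in>V. \<phi> (act x v) = act' x (\<phi> v)))"

definition pullback :: "('a \<Rightarrow> 'b) \<Rightarrow> ('b \<Rightarrow> 'v \<Rightarrow> 'v) \<Rightarrow> 'a \<Rightarrow> 'v \<Rightarrow> 'v" where
  "pullback h act x v = act (h x) v"

definition tensor_act ::
  "('a::complex_algebra_1 \<Rightarrow> 'v::complex_vector \<Rightarrow> 'v) \<Rightarrow>
   ('b::complex_algebra_1 \<Rightarrow> 'w::complex_vector \<Rightarrow> 'w) \<Rightarrow>
   ('a, 'b) tensor \<Rightarrow> ('v, 'w) tensor \<Rightarrow> ('v, 'w) tensor" where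
  "tensor_act act act' z t =
     tensor_lift (\<lambda>x y. tensor_lift (\<lambda>v w. act x v \<otimes> act' y w) t) z"

lemma clinear_comp: "clinear f \<Longrightarrow> clinear g \<Longrightarrow> clinear (\<lambda>x. f (g x))"
  by (simp add: clinear_def)

lemma tensor_clinear_eqI:
  fixes f g :: "('a::complex_vector, 'b::complex_vector) tensor \<Rightarrow> 'c::complex_vector"
  assumes f: "clinear f" and g: "clinear g" and eq: "\<And>a b. f (a \<otimes> b) = g (a \<otimes> b)"
  shows "f t = g t"
proof -
  have l: "clinear (abs_tensor :: _ \<Rightarrow> ('a, 'b) tensor)"
    by (simp add: clinear_def plus_tensor.abs_eq scaleC_tensor.abs_eq)
  have "f (abs_tensor p) = g (abs_tensor p)" for p
  proof (rule clinear_pm_eqI[OF clinear_comp[OF f l] clinear_comp[OF g l]])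
    fix k :: "('a, 'b) pt"
    show "f (abs_tensor (Poly_Mapping.single k 1)) = g (abs_tensor (Poly_Mapping.single k 1))"
      using eq[of "pfst k" "psnd k"] by (simp add: tensor_of.abs_eq ptens_def)
  qed
  then show ?thesis by (metis Quotient3_abs_rep[OF Quotient3_tensor])
qed

lemma
  assumes "module_on act UNIV" and "module_on act' UNIV"
  shows tensor_act_tensor: "tensor_act act act' (x \<otimes> y) (v \<otimes> w) = act x v \<otimes> act' y w"
    and tensor_act_module: "module_on (tensor_act act act') UNIV"
proof -
  have ot: "clinear ((\<otimes>) a)" "clinear (\<lambda>a. a \<otimes> b)" for a :: 'b and b :: 'd
    using tensor_of_bilinear by (auto simp: cbilinear_def)
  note ot_simps = clinear_add[OF ot(1)] clinear_add[OF ot(2)] clinear_scale[OF ot(1)] clinear_scale[OF ot(2)]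
  have M: "act x (v + v') = act x v + act x v'" "act x (c *\<^sub>C v) = c *\<^sub>C act x v"
    "act (x + x') v = act x v + act x' v" "act (c *\<^sub>C x) v = c *\<^sub>C act x v"
    "act 1 v = v" "act (x * x') v = act x (act x' v)" for x x' v v' c
    using assms(1) by (auto simp: module_on_def)
  have M': "act' x (v + v') = act' x v + act' x v'" "act' x (c *\<^sub>C v) = c *\<^sub>C act' x v"
    "act' (x + x') v = act' x v + act' x' v" "act' (c *\<^sub>C x) v = c *\<^sub>C act' x v"
    "act' 1 v = v" "act' (x * x') v = act' x (act' x' v)" for x x' v v' c
    using assms(2) by (auto simp: module_on_def)
  have b1: "cbilinear (\<lambda>v w. act x v \<otimes> act' y w)" for x y
    by (simp add: cbilinear_def clinear_def M M' ot_simps)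
  note i = tensor_lift_bilinear[OF b1]
  have b2: "cbilinear (\<lambda>x y. tensor_lift (\<lambda>v w. act x v \<otimes> act' y w) t)" for t
    unfolding cbilinear_def
  proof (intro conjI allI clinearI)
    fix x x' y y' c
    note [simp] = clinear_add[OF i(1)] clinear_scale[OF i(1)]
    show "tensor_lift (\<lambda>v w. act x v \<otimes> act' (y + y') w) t =
      tensor_lift (\<lambda>v w. act x v \<otimes> act' y w) t + tensor_lift (\<lambda>v w. act x v \<otimes> act' y' w) t"
      by (rule tensor_clinear_eqI[OF i(1)], rule clinearI, simp_all add: i(2) scaleC_add_right)
        (simp add: M' ot_simps)
    show "tensor_lift (\<lambda>v w. act x v \<otimes> act' (c *\<^sub>C y) w) t =
      c *\<^sub>C tensor_lift (\<lambda>v w. act x v \<otimes> act' y w) t"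
      by (rule tensor_clinear_eqI[OF i(1)], rule clinearI,
          simp_all add: i(2) scaleC_add_right scaleC_scaleC mult.commute)
        (simp add: M' ot_simps)
    show "tensor_lift (\<lambda>v w. act (x + x') v \<otimes> act' y w) t =
      tensor_lift (\<lambda>v w. act x v \<otimes> act' y w) t + tensor_lift (\<lambda>v w. act x' v \<otimes> act' y w) t"
      by (rule tensor_clinear_eqI[OF i(1)], rule clinearI, simp_all add: i(2) scaleC_add_right)
        (simp add: M ot_simps)
    show "tensor_lift (\<lambda>v w. act (c *\<^sub>C x) v \<otimes> act' y w) t =
      c *\<^sub>C tensor_lift (\<lambda>v w. act x v \<otimes> act' y w) t"
      by (rule tensor_clinear_eqI[OF i(1)], rule clinearI,
          simp_all add: i(2) scaleC_add_right scaleC_scaleC mult.commute)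
        (simp add: M ot_simps)
  qed
  note o = tensor_lift_bilinear[OF b2, folded tensor_act_def]
  have T: "tensor_act act act' (x \<otimes> y) t = tensor_lift (\<lambda>v w. act x v \<otimes> act' y w) t" for x y t
    by (rule o(2))
  show "tensor_act act act' (x \<otimes> y) (v \<otimes> w) = act x v \<otimes> act' y w"
    by (simp add: T i(2))
  have L1: "clinear (\<lambda>z. tensor_act act act' z t)" for t
    using o(1) by (simp add: tensor_act_def)
  have L2: "clinear (tensor_act act act' z)" for z
  proof (rule clinearI)
    fix t t' c
    have *: "clinear (\<lambda>z. tensor_act act act' z t + tensor_act act act' z t')"
      "clinear (\<lambda>z. c *\<^sub>C tensor_act act act' z t)"
      by (rule clinearI, simp_all add: clinear_add[OF L1] clinear_scale[OF L1] scaleC_add_right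
          scaleC_scaleC mult.commute)+
    show "tensor_act act act' z (t + t') = tensor_act act act' z t + tensor_act act act' z t'"
      by (rule tensor_clinear_eqI[OF L1 *(1)]) (simp add: T clinear_add[OF i(1)])
    show "tensor_act act act' z (c *\<^sub>C t) = c *\<^sub>C tensor_act act act' z t"
      by (rule tensor_clinear_eqI[OF L1 *(2)]) (simp add: T clinear_scale[OF i(1)])
  qed
  have "tensor_act act act' 1 t = t" for t
    by (rule tensor_clinear_eqI[OF L2])
      (simp add: clinear_def, simp add: T M M' tensor_lift_bilinear(2)[OF tensor_of_bilinear] flip: tensor_one)
  moreover have "tensor_act act act' (z * z') t = tensor_act act act' z (tensor_act act act' z' t)"
    for z z' t
  proof (rule tensor_clinear_eqI[of "\<lambda>z. tensor_act act act' (z * z') t"])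
    show "clinear (\<lambda>z. tensor_act act act' (z * z') t)"
      by (rule clinearI)
        (simp_all add: distrib_right mult_scaleC_left clinear_add[OF L1] clinear_scale[OF L1])
    show "clinear (\<lambda>z. tensor_act act act' z (tensor_act act act' z' t))" by (rule L1)
    fix a b
    show "tensor_act act act' (a \<otimes> b * z') t = tensor_act act act' (a \<otimes> b) (tensor_act act act' z' t)"
    proof (rule tensor_clinear_eqI[of "\<lambda>z'. tensor_act act act' (a \<otimes> b * z') t"])
      show "clinear (\<lambda>z'. tensor_act act act' (a \<otimes> b * z') t)"
        by (rule clinearI)
          (simp_all add: distrib_left mult_scaleC_right clinear_add[OF L1] clinear_scale[OF L1])
      show "clinear (\<lambda>z'. tensor_act act act' (a \<otimes> b) (tensor_act act act' z' t))"
        by (rule clinear_comp[OF L2 L1])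
      fix c d
      show "tensor_act act act' (a \<otimes> b * c \<otimes> d) t =
        tensor_act act act' (a \<otimes> b) (tensor_act act act' (c \<otimes> d) t)"
        by (rule tensor_clinear_eqI[OF L2 clinear_comp[OF L2 L2]])
          (simp only: tensor_mult T i(2), simp add: M M')
    qed
  qed
  ultimately show "module_on (tensor_act act act') UNIV"
    by (simp add: module_on_def clinear_add[OF L1] clinear_add[OF L2] clinear_scale[OF L1]
        clinear_scale[OF L2])
qed

typedef (overloaded) 'v endo = "{f :: 'v::complex_vector \<Rightarrow> 'v. clinear f}"
  morphisms app_endo Endo
  by (rule exI[of _ id]) (simp add: clinear_def)

setup_lifting type_definition_endo

instantiation endo :: (complex_vector) complex_algebra_1
begin
lift_definition zero_endo :: "'a endo" is "\<lambda>v. 0" by (simp add: clinear_def)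
lift_definition one_endo :: "'a endo" is "\<lambda>v. v" by (simp add: clinear_def)
lift_definition plus_endo :: "'a endo \<Rightarrow> 'a endo \<Rightarrow> 'a endo" is "\<lambda>f g v. f v + g v"
  by (simp add: clinear_def scaleC_add_right algebra_simps)
lift_definition uminus_endo :: "'a endo \<Rightarrow> 'a endo" is "\<lambda>f v. - f v"
  by (simp add: clinear_def)
lift_definition minus_endo :: "'a endo \<Rightarrow> 'a endo \<Rightarrow> 'a endo" is "\<lambda>f g v. f v - g v"
  by (simp add: clinear_def cvec.scale_right_diff_distrib)
lift_definition times_endo :: "'a endo \<Rightarrow> 'a endo \<Rightarrow> 'a endo" is "\<lambda>f g v. f (g v)"
  by (simp add: clinear_def)
lift_definition scaleC_endo :: "complex \<Rightarrow> 'a endo \<Rightarrow> 'a endo" is "\<lambda>c f v. c *\<^sub>C f v"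
  by (simp add: clinear_def scaleC_add_right scaleC_scaleC mult.commute)
instance
  by standard (transfer; simp add: fun_eq_iff clinear_add clinear_scale scaleC_add_right
      scaleC_add_left scaleC_scaleC scaleC_one algebra_simps)+
end


section \<open>The universal enveloping algebra of sl(2)\<close>

datatype sl2gen = gE | gF | gH

instantiation sl2gen :: presentation
begin
definition relators_sl2gen :: "sl2gen free_alg set" where
  "relators_sl2gen =
     {[fgen gH, fgen gE]\<^sub>c - 2 *\<^sub>C fgen gE,
      [fgen gH, fgen gF]\<^sub>c - (- 2) *\<^sub>C fgen gF,
      [fgen gE, fgen gF]\<^sub>c - fgen gH}"
instance ..
end

type_synonym usl2 = "sl2gen presented"
type_synonym usl2_2 = "(usl2, usl2) tensor"

abbreviation "E \<equiv> pgen gE"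
abbreviation "F \<equiv> pgen gF"
abbreviation "H \<equiv> pgen gH"

definition casimir :: usl2 where
  "casimir = E * F + F * E + (1 / 2) *\<^sub>C H ^ 2"

definition comult :: "usl2 \<Rightarrow> usl2_2" where
  "comult = pres_lift (\<lambda>g. pgen g \<otimes> 1 + 1 \<otimes> pgen g)"

lemma free_eval_simps:
  "free_eval f (x + y) = free_eval f x + free_eval f y"
  "free_eval f (x - y) = free_eval f x - free_eval f y"
  "free_eval f (c *\<^sub>C x) = c *\<^sub>C free_eval f x"
  "free_eval f (x * y) = free_eval f x * free_eval f y"
  "free_eval f [x, y]\<^sub>c = [free_eval f x, free_eval f y]\<^sub>c"
  "free_eval f (fgen g) = f g"
  by (simp_all add: clinear_add clinear_diff clinear_scale algebra_hom_mult algebra_hom_commutator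
      algebra_hom_clinear free_eval_hom free_eval_gen)

lemma usl2_relations: "[H, E]\<^sub>c = 2 *\<^sub>C E" "[H, F]\<^sub>c = (- 2) *\<^sub>C F" "[E, F]\<^sub>c = H"
proof -
  have "\<forall>r\<in>relators. free_eval (pgen :: sl2gen \<Rightarrow> _) r = 0" using presented_relator by blast
  then show "[H, E]\<^sub>c = 2 *\<^sub>C E" "[H, F]\<^sub>c = (- 2) *\<^sub>C F" "[E, F]\<^sub>c = H"
    by (simp_all add: relators_sl2gen_def free_eval_simps eq_neg_iff_add_eq_0)
qed

lemma usl2_lift_hom:
  assumes "[f gH, f gE]\<^sub>c = 2 *\<^sub>C f gE" "[f gH, f gF]\<^sub>c = (- 2) *\<^sub>C f gF" "[f gE, f gF]\<^sub>c = f gH"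
  shows "algebra_hom (pres_lift f)" "pres_lift f (pgen g) = f g"
proof -
  have "free_eval f r = 0" if "r \<in> relators" for r
    using that assms by (auto simp: relators_sl2gen_def free_eval_simps)
  then show "algebra_hom (pres_lift f)" "pres_lift f (pgen g) = f g"
    using pres_lift_hom by blast+
qed

lemma tensor_simps:
  "(a + a') \<otimes> b = a \<otimes> b + a' \<otimes> b" "a \<otimes> (b + b') = a \<otimes> b + a \<otimes> b'"
  "(a - a') \<otimes> b = a \<otimes> b - a' \<otimes> b" "a \<otimes> (b - b') = a \<otimes> b - a \<otimes> b'"
  "(c *\<^sub>C a) \<otimes> b = c *\<^sub>C (a \<otimes> b)" "a \<otimes> (c *\<^sub>C b) = c *\<^sub>C (a \<otimes> b)"
proof -
  have ot: "clinear ((\<otimes>) a)" "clinear (\<lambda>a. a \<otimes> b)" for a :: 'a and b :: 'b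
    using tensor_of_bilinear by (auto simp: cbilinear_def)
  show "(a + a') \<otimes> b = a \<otimes> b + a' \<otimes> b" "a \<otimes> (b + b') = a \<otimes> b + a \<otimes> b'"
    "(a - a') \<otimes> b = a \<otimes> b - a' \<otimes> b" "a \<otimes> (b - b') = a \<otimes> b - a \<otimes> b'"
    "(c *\<^sub>C a) \<otimes> b = c *\<^sub>C (a \<otimes> b)" "a \<otimes> (c *\<^sub>C b) = c *\<^sub>C (a \<otimes> b)"
    using clinear_add[OF ot(1)] clinear_add[OF ot(2)] clinear_diff[OF ot(1)] clinear_diff[OF ot(2)]
      clinear_scale[OF ot(1)] clinear_scale[OF ot(2)] by auto
qed

lemma comult_hom: "algebra_hom comult" "comult (pgen g) = pgen g \<otimes> 1 + 1 \<otimes> pgen g"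
proof -
  have *: "[x \<otimes> 1 + 1 \<otimes> x, y \<otimes> 1 + 1 \<otimes> y]\<^sub>c = [x, y]\<^sub>c \<otimes> 1 + 1 \<otimes> [x, y]\<^sub>c" for x y :: usl2
    by (simp add: commutator_def algebra_simps tensor_mult tensor_simps)
  show "algebra_hom comult" "comult (pgen g) = pgen g \<otimes> 1 + 1 \<otimes> pgen g"
    unfolding comult_def
    by (rule usl2_lift_hom; simp only: * usl2_relations tensor_simps scaleC_add_right)+
qed


section \<open>The finite-dimensional modules\<close>

text \<open>The basis vector \<open>v\<^sub>i\<close> is \<open>Poly_Mapping.single i 1\<close>; the operators are extended by zero to the
  basis vectors with index above \<open>n\<close>, which lie outside \<open>L n\<close>.\<close>

definition L :: "nat \<Rightarrow> (nat \<Rightarrow>\<^sub>0 complex) set" where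
  "L n = cspan {Poly_Mapping.single i 1 | i. i \<le> n}"

fun L_gen :: "nat \<Rightarrow> sl2gen \<Rightarrow> nat \<Rightarrow> (nat \<Rightarrow>\<^sub>0 complex)" where
  "L_gen n gE i = (if 1 \<le> i \<and> i \<le> n then of_nat i *\<^sub>C Poly_Mapping.single (i - 1) 1 else 0)"
| "L_gen n gF i = (if i < n then (of_nat n - of_nat i) *\<^sub>C Poly_Mapping.single (i + 1) 1 else 0)"
| "L_gen n gH i = (if i \<le> n then (of_nat n - 2 * of_nat i) *\<^sub>C Poly_Mapping.single i 1 else 0)"

definition L_rep :: "nat \<Rightarrow> usl2 \<Rightarrow> (nat \<Rightarrow>\<^sub>0 complex) endo" where
  "L_rep n = pres_lift (\<lambda>g. Endo (lin_ext (L_gen n g)))"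

definition L_act :: "nat \<Rightarrow> usl2 \<Rightarrow> (nat \<Rightarrow>\<^sub>0 complex) \<Rightarrow> (nat \<Rightarrow>\<^sub>0 complex)" where
  "L_act n x = app_endo (L_rep n x)"

lemma L_rep_hom: "algebra_hom (L_rep n)" "L_rep n (pgen g) = Endo (lin_ext (L_gen n g))"
proof -
  let ?f = "\<lambda>g. Endo (lin_ext (L_gen n g))"
  have a: "app_endo (Endo (lin_ext f)) = lin_ext f" for f :: "nat \<Rightarrow> (nat \<Rightarrow>\<^sub>0 complex)"
    by (simp add: Endo_inverse lin_ext_clinear)
  have eqI: "x = y" if "\<And>i. app_endo x (Poly_Mapping.single i 1) = app_endo y (Poly_Mapping.single i 1)"
    for x y :: "(nat \<Rightarrow>\<^sub>0 complex) endo"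
    using that app_endo[of x] app_endo[of y] clinear_pm_eqI[of "app_endo x" "app_endo y"]
    by (auto simp flip: app_endo_inject)
  note s = commutator_def minus_endo.rep_eq uminus_endo.rep_eq times_endo.rep_eq scaleC_endo.rep_eq a lin_ext_single
    clinear_scale[OF lin_ext_clinear] clinear_zero[OF lin_ext_clinear] scaleC_scaleC scaleC_single scaleC_complex_def
  have 1: "[?f gH, ?f gE]\<^sub>c = 2 *\<^sub>C ?f gE"
    by (rule eqI) (auto simp: s of_nat_diff algebra_simps simp del: single_one simp flip: single_add single_diff single_uminus)
  have 2: "[?f gH, ?f gF]\<^sub>c = (- 2) *\<^sub>C ?f gF"
    by (rule eqI) (auto simp: s of_nat_diff algebra_simps simp del: single_one simp flip: single_add single_diff single_uminus)
  have 3: "[?f gE, ?f gF]\<^sub>c = ?f gH"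
  proof (rule eqI)
    fix i
    consider "i < n" "i = 0" | "i < n" "i > 0" | "i = n" "i > 0" | "i = n" "i = 0" | "i > n" by linarith
    then show "app_endo [?f gE, ?f gF]\<^sub>c (Poly_Mapping.single i 1) =
        app_endo (?f gH) (Poly_Mapping.single i 1)"
      by cases (auto simp: s of_nat_diff algebra_simps simp del: single_one simp flip: single_add single_diff single_uminus)
  qed
  from usl2_lift_hom[of ?f, OF 1 2 3]
  show "algebra_hom (L_rep n)" "L_rep n (pgen g) = Endo (lin_ext (L_gen n g))"
    by (simp_all add: L_rep_def)
qed

lemma L_act_module: "module_on (L_act n) UNIV"
proof -
  note h = L_rep_hom(1)[of n] and l = algebra_hom_clinear[OF L_rep_hom(1)[of n]]
  have "clinear (app_endo f)" for f :: "(nat \<Rightarrow>\<^sub>0 complex) endo"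
    using app_endo by blast
  then show ?thesis
    by (simp add: module_on_def L_act_def clinear_add[OF l] clinear_scale[OF l] algebra_hom_one[OF h]
        algebra_hom_mult[OF h] plus_endo.rep_eq scaleC_endo.rep_eq one_endo.rep_eq times_endo.rep_eq
        clinear_add clinear_scale)
qed

lemma L_act_gen: "L_act n (pgen g) (Poly_Mapping.single i 1) = L_gen n g i"
  by (simp add: L_act_def L_rep_hom Endo_inverse lin_ext_clinear lin_ext_single scaleC_one)

text \<open>\<open>L m \<otimes> L n\<close>, realised inside the tensor product of the ambient spaces (tensor products over a
  field preserve inclusions).\<close>

definition LL :: "nat \<Rightarrow> nat \<Rightarrow> (nat \<Rightarrow>\<^sub>0 complex, nat \<Rightarrow>\<^sub>0 complex) tensor set" where
  "LL m n = cspan {v \<otimes> w | v w. v \<in> L m \<and> w \<in> L n}"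

definition LL_act :: "nat \<Rightarrow> nat \<Rightarrow> usl2_2 \<Rightarrow>
    (nat \<Rightarrow>\<^sub>0 complex, nat \<Rightarrow>\<^sub>0 complex) tensor \<Rightarrow> (nat \<Rightarrow>\<^sub>0 complex, nat \<Rightarrow>\<^sub>0 complex) tensor" where
  "LL_act m n = tensor_act (L_act m) (L_act n)"

definition weight_space ::
  "(usl2_2 \<Rightarrow> 'v::complex_vector \<Rightarrow> 'v) \<Rightarrow> 'v set \<Rightarrow> complex \<Rightarrow> 'v set" where
  "weight_space act V \<theta> = {v \<in> V. act (comult H) v = \<theta> *\<^sub>C v}"


section \<open>The universal Hahn algebra\<close>

datatype hahngen = gA | gB | gC

definition hahn_alpha :: "hahngen free_alg" where
  "hahn_alpha = [fgen gC, fgen gA]\<^sub>c + 2 *\<^sub>C fgen gA ^ 2 + fgen gB"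

definition hahn_beta :: "hahngen free_alg" where
  "hahn_beta = [fgen gB, fgen gC]\<^sub>c + 4 *\<^sub>C (fgen gB * fgen gA) + 2 *\<^sub>C fgen gC"

instantiation hahngen :: presentation
begin
definition relators_hahngen :: "hahngen free_alg set" where
  "relators_hahngen =
     {[fgen gA, fgen gB]\<^sub>c - fgen gC} \<union> {[hahn_alpha, x]\<^sub>c | x. True} \<union> {[hahn_beta, x]\<^sub>c | x. True}"
instance ..
end

type_synonym hahn = "hahngen presented"

fun natural_gen :: "hahngen \<Rightarrow> usl2_2" where
  "natural_gen gA = (1 / 4) *\<^sub>C (H \<otimes> 1 - 1 \<otimes> H)"
| "natural_gen gB = (1 / 2) *\<^sub>C comult casimir"
| "natural_gen gC = E \<otimes> F - F \<otimes> E"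

definition natural :: "hahn \<Rightarrow> usl2_2" where
  "natural = pres_lift natural_gen"

lemma free_eval_commute:
  assumes "\<And>g. z * f g = f g * z"
  shows "z * free_eval f x = free_eval f x * z"
proof (rule clinear_pm_eqI[of "\<lambda>x. z * free_eval f x" "\<lambda>x. free_eval f x * z"])
  show "clinear (\<lambda>x. z * free_eval f x)" "clinear (\<lambda>x. free_eval f x * z)"
    by (rule clinearI; simp add: free_eval_simps algebra_simps mult_scaleC_left mult_scaleC_right)+
  fix k
  have "z * prod_list (map f w) = prod_list (map f w) * z" for w
    by (induction w) (simp_all add: assms mult.assoc, metis assms mult.assoc)
  then show "z * free_eval f (Poly_Mapping.single k 1) = free_eval f (Poly_Mapping.single k 1) * z"
    by (simp add: free_eval_def lin_ext_single scaleC_one)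
qed

lemma hahn_identities:
  fixes e1 f1 h1 e2 f2 h2 :: "'a::complex_algebra_1"
  assumes r1: "h1 * e1 = e1 * h1 + e1 + e1" "h1 * f1 = f1 * h1 - f1 - f1" "e1 * f1 = f1 * e1 + h1"
    and r2: "h2 * e2 = e2 * h2 + e2 + e2" "h2 * f2 = f2 * h2 - f2 - f2" "e2 * f2 = f2 * e2 + h2"
    and c: "e2 * e1 = e1 * e2" "e2 * f1 = f1 * e2" "e2 * h1 = h1 * e2"
      "f2 * e1 = e1 * f2" "f2 * f1 = f1 * f2" "f2 * h1 = h1 * f2"
      "h2 * e1 = e1 * h2" "h2 * f1 = f1 * h2" "h2 * h1 = h1 * h2"
  defines "a \<equiv> (1 / 4) *\<^sub>C (h1 - h2)"
    and "la1 \<equiv> e1 * f1 + f1 * e1 + (1 / 2) *\<^sub>C (h1 * h1)"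
    and "la2 \<equiv> e2 * f2 + f2 * e2 + (1 / 2) *\<^sub>C (h2 * h2)"
    and "b \<equiv> (1 / 2) *\<^sub>C ((e1 + e2) * (f1 + f2) + (f1 + f2) * (e1 + e2)
           + (1 / 2) *\<^sub>C ((h1 + h2) * (h1 + h2)))"
    and "cc \<equiv> e1 * f2 - f1 * e2"
  shows "[a, b]\<^sub>c = cc"
    and "x \<in> {a, b, cc} \<Longrightarrow>
      ([cc, a]\<^sub>c + 2 *\<^sub>C (a * a) + b) * x = x * ([cc, a]\<^sub>c + 2 *\<^sub>C (a * a) + b)"
    and "x \<in> {a, b, cc} \<Longrightarrow>
      ([b, cc]\<^sub>c + 4 *\<^sub>C (b * a) + 2 *\<^sub>C cc) * x = x * ([b, cc]\<^sub>c + 4 *\<^sub>C (b * a) + 2 *\<^sub>C cc)"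
proof -
  have as: "x * y = z \<Longrightarrow> x * (y * w) = z * w" for x y z w :: 'a by (simp flip: mult.assoc)
  note R = r1 r2 c r1[THEN as] r2[THEN as] c[THEN as]
  note D = mult_scaleC_left mult_scaleC_right distrib_left distrib_right left_diff_distrib
    right_diff_distrib mult.assoc scaleC_add_right cvec.scale_right_diff_distrib scaleC_scaleC
    commutator_def
  have n2: "2 *\<^sub>C x = x + x" for x :: 'a
    using scaleC_add_left[of 1 1 x] by (simp add: scaleC_one)
  have n4: "4 *\<^sub>C x = x + x + x + x" for x :: 'a
    using scaleC_add_left[of 2 2 x] by (simp add: n2 add.assoc)
  have n8: "8 *\<^sub>C x = x + x + x + x + x + x + x + x" for x :: 'a
    using scaleC_add_left[of 4 4 x] by (simp add: n4 add.assoc)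
  have n16: "16 *\<^sub>C x = 8 *\<^sub>C x + 8 *\<^sub>C x" for x :: 'a
    using scaleC_add_left[of 8 8 x] by simp
  note n = n2 n4 n8 n16
  have m: "x = y" if "8 *\<^sub>C x = 8 *\<^sub>C y" for x y :: 'a
    using that by simp
  show "[a, b]\<^sub>c = cc"
    unfolding a_def b_def cc_def
    by (rule m) (simp add: D R, simp add: n algebra_simps)
  have A: "[cc, a]\<^sub>c + 2 *\<^sub>C (a * a) + b =
      (1 / 2) *\<^sub>C (la1 + la2) + (1 / 8) *\<^sub>C ((h1 + h2) * (h1 + h2))"
    unfolding a_def b_def cc_def la1_def la2_def
    by (rule m) (simp add: D R, simp add: n algebra_simps)
  have B: "[b, cc]\<^sub>c + 4 *\<^sub>C (b * a) + 2 *\<^sub>C cc = (1 / 2) *\<^sub>C ((la1 - la2) * (h1 + h2))"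
    unfolding a_def b_def cc_def la1_def la2_def
    by (rule m) (simp add: D R, simp add: n algebra_simps)
  have "la1 * e1 = e1 * la1" "la1 * f1 = f1 * la1" "la1 * h1 = h1 * la1"
    "la1 * e2 = e2 * la1" "la1 * f2 = f2 * la1" "la1 * h2 = h2 * la1"
    unfolding la1_def by (rule m, simp add: D R, (simp add: n algebra_simps)?)+
  then have l1: "la1 * x = x * la1" if "x \<in> {e1, f1, h1, e2, f2, h2}" for x
    using that by blast
  have "la2 * e1 = e1 * la2" "la2 * f1 = f1 * la2" "la2 * h1 = h1 * la2"
    "la2 * e2 = e2 * la2" "la2 * f2 = f2 * la2" "la2 * h2 = h2 * la2"
    unfolding la2_def by (rule m, simp add: D R, (simp add: n algebra_simps)?)+
  then have l2: "la2 * x = x * la2" if "x \<in> {e1, f1, h1, e2, f2, h2}" for x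
    using that by blast
  have cadd: "z * (x + y) = (x + y) * z" if "z * x = x * z" "z * y = y * z" for x y z :: 'a
    using that by (simp add: distrib_left distrib_right)
  have cdiff: "z * (x - y) = (x - y) * z" if "z * x = x * z" "z * y = y * z" for x y z :: 'a
    using that by (simp add: left_diff_distrib right_diff_distrib)
  have cmul: "z * (x * y) = (x * y) * z" if "z * x = x * z" "z * y = y * z" for x y z :: 'a
    using that by (metis mult.assoc)
  have cscale: "z * (c *\<^sub>C x) = (c *\<^sub>C x) * z" if "z * x = x * z" for x z :: 'a and c
    using that by (simp add: mult_scaleC_left mult_scaleC_right)
  have "la1 * a = a * la1" "la1 * b = b * la1" "la1 * cc = cc * la1"
    unfolding a_def b_def cc_def by (intro cadd cdiff cmul cscale l1; simp)+
  moreover have "la2 * a = a * la2" "la2 * b = b * la2" "la2 * cc = cc * la2"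
    unfolding a_def b_def cc_def by (intro cadd cdiff cmul cscale l2; simp)+
  ultimately have la: "la1 * x = x * la1 \<and> la2 * x = x * la2" if "x \<in> {a, b, cc}" for x
    using that by blast
  have "(h1 + h2) * a = a * (h1 + h2)" "(h1 + h2) * b = b * (h1 + h2)"
    "(h1 + h2) * cc = cc * (h1 + h2)"
    unfolding a_def b_def cc_def
    by (rule m, simp add: D R, (simp add: n algebra_simps)?)+
  then have h: "(h1 + h2) * x = x * (h1 + h2)" if "x \<in> {a, b, cc}" for x
    using that by blast
  show "([cc, a]\<^sub>c + 2 *\<^sub>C (a * a) + b) * x = x * ([cc, a]\<^sub>c + 2 *\<^sub>C (a * a) + b)"
    if "x \<in> {a, b, cc}"
  proof -
    have "(h1 + h2) * (h1 + h2) * x = x * ((h1 + h2) * (h1 + h2))"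
      using h[OF that] by (metis mult.assoc)
    with la[OF that] show ?thesis
      unfolding A by (simp only: distrib_left[of x] distrib_right[of _ _ x]
          mult_scaleC_left mult_scaleC_right)
  qed
  show "([b, cc]\<^sub>c + 4 *\<^sub>C (b * a) + 2 *\<^sub>C cc) * x = x * ([b, cc]\<^sub>c + 4 *\<^sub>C (b * a) + 2 *\<^sub>C cc)"
    if "x \<in> {a, b, cc}"
  proof -
    have "(la1 - la2) * x = x * (la1 - la2)"
      using la[OF that] by (simp add: left_diff_distrib right_diff_distrib)
    then have "(la1 - la2) * (h1 + h2) * x = x * ((la1 - la2) * (h1 + h2))"
      using h[OF that] by (metis mult.assoc)
    then show ?thesis
      unfolding B by (simp only: mult_scaleC_left mult_scaleC_right)
  qed
qed

lemma natural_hom: "algebra_hom natural" "natural (pgen g) = natural_gen g"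
proof -
  let ?e1 = "E \<otimes> (1::usl2)" and ?f1 = "F \<otimes> (1::usl2)" and ?h1 = "H \<otimes> (1::usl2)"
  let ?e2 = "(1::usl2) \<otimes> E" and ?f2 = "(1::usl2) \<otimes> F" and ?h2 = "(1::usl2) \<otimes> H"
  have two: "2 *\<^sub>C x = x + x" for x :: usl2
    using scaleC_add_left[of 1 1 x] by (simp add: scaleC_one)
  have r: "H * E = E * H + E + E" "H * F = F * H - F - F" "E * F = F * E + H"
    using usl2_relations by (simp_all add: commutator_def two algebra_simps)
  note I = hahn_identities[of ?h1 ?e1 ?f1 ?h2 ?e2 ?f2]
  have B: "natural_gen gB = (1 / 2) *\<^sub>C ((?e1 + ?e2) * (?f1 + ?f2) + (?f1 + ?f2) * (?e1 + ?e2)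
           + (1 / 2) *\<^sub>C ((?h1 + ?h2) * (?h1 + ?h2)))"
    using comult_hom
    by (simp add: casimir_def power2_eq_square algebra_hom_clinear clinear_add clinear_scale
        algebra_hom_mult)
  have C: "natural_gen gC = ?e1 * ?f2 - ?f1 * ?e2" by (simp add: tensor_mult)
  have A: "natural_gen gA = (1 / 4) *\<^sub>C (?h1 - ?h2)" by simp
  have g: "natural_gen g \<in> {natural_gen gA, natural_gen gB, natural_gen gC}" for g
    by (cases g) simp_all
  have I': "[natural_gen gA, natural_gen gB]\<^sub>c = natural_gen gC"
    "free_eval natural_gen hahn_alpha * natural_gen g = natural_gen g * free_eval natural_gen hahn_alpha"
    "free_eval natural_gen hahn_beta * natural_gen g = natural_gen g * free_eval natural_gen hahn_beta"
    for g
    using I(1) I(2,3)[of "natural_gen g"] g[of g]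
    unfolding A B C hahn_alpha_def hahn_beta_def free_eval_simps power2_eq_square
    by (simp_all add: tensor_mult r tensor_simps)
  have "free_eval natural_gen r = 0" if "r \<in> relators" for r
    using that I'(1) free_eval_commute[OF I'(2)] free_eval_commute[OF I'(3)]
    by (auto simp: relators_hahngen_def free_eval_simps commutator_def simp del: natural_gen.simps)
  then show "algebra_hom natural" "natural (pgen g) = natural_gen g"
    unfolding natural_def using pres_lift_hom by blast+
qed

definition hahn_act :: "nat \<Rightarrow> nat \<Rightarrow> hahn \<Rightarrow>
    (nat \<Rightarrow>\<^sub>0 complex, nat \<Rightarrow>\<^sub>0 complex) tensor \<Rightarrow> (nat \<Rightarrow>\<^sub>0 complex, nat \<Rightarrow>\<^sub>0 complex) tensor" where
  "hahn_act m n = pullback natural (LL_act m n)"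

end

theory Submission
  imports Defs
begin

text \<open>The weight space has the basis \<open>v\<^sub>i \<otimes> w\<^sub>j\<close> with \<open>i + j = l\<close>; numbered from its first element, it is a
  string \<open>U\<^sub>0, \<dots>, U\<^sub>d\<close> on which \<open>A\<close> is diagonal with simple spectrum and \<open>B\<close>, \<open>C\<close> are tridiagonal with
  nonvanishing off-diagonal entries \<open>k (k + f)\<close> and \<open>(d - k) (d + e - k)\<close>, where \<open>e = |m - l|\<close> and
  \<open>f = |n - l|\<close>. Irreducibility follows. All matrix entries depend on \<open>(d, e, f)\<close> only, and conversely the
  spectrum of \<open>A\<close> determines \<open>d\<close> and \<open>e - f\<close>, while the first diagonal entry of \<open>B\<close> is, for these values,
  strictly increasing in \<open>f\<close>. So the isomorphism class is equivalent to the triple \<open>(d, e, f)\<close>.\<close>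

section \<open>Induction over presented algebras and symmetry of module isomorphism\<close>

text \<open>Every element is the class of a finite linear combination of words, and a word is a
  product of generators. Claims about the action of all of \<open>hahn\<close> are thereby reduced
  to \<open>A\<close>, \<open>B\<close> and \<open>C\<close>.\<close>

lemma presented_induct:
  assumes one: "P 1" and gen: "\<And>g. P (pgen g)"
    and add: "\<And>x y. P x \<Longrightarrow> P y \<Longrightarrow> P (x + y)" and mult: "\<And>x y. P x \<Longrightarrow> P y \<Longrightarrow> P (x * y)"
    and scale: "\<And>c x. P x \<Longrightarrow> P (c *\<^sub>C x)"
  shows "P (x :: 'g::presentation presented)"
proof -
  have zero: "P 0" using scale[OF one, of 0] by simp
  have word: "P (abs_presented (Poly_Mapping.single (Word w) 1))" for w :: "'g list"
  proof (induction w)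
    case Nil
    then show ?case using one by (simp add: one_presented.abs_eq zero_fmon_def flip: single_one)
  next
    case (Cons g w)
    have "Poly_Mapping.single (Word (g # w)) 1 = fgen g * Poly_Mapping.single (Word w) 1"
      by (simp add: fgen_def mult_single plus_fmon_def)
    then show ?case
      using mult[OF gen[of g] Cons] by (simp add: pgen.abs_eq times_presented.abs_eq)
  qed
  have word': "P (abs_presented (Poly_Mapping.single k 1))" for k :: "'g fmon"
    using word[of "letters k"] by simp
  obtain p where p: "x = abs_presented p" by (metis Quotient3_abs_rep[OF Quotient3_presented])
  have "P (abs_presented (\<Sum>k\<in>S. c k *\<^sub>C Poly_Mapping.single k 1))"
    if "finite S" for S :: "'g fmon set" and c
    using that
  proof induction
    case empty
    then show ?case using zero by (simp add: zero_presented.abs_eq)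
  next
    case (insert k S)
    then show ?case
      using add[OF scale[OF word'] insert.IH]
      by (simp add: plus_presented.abs_eq scaleC_presented.abs_eq)
  qed
  from this[OF finite_keys] show ?thesis unfolding p by (subst pm_decomp)
qed

text \<open>The inverse bijection is linear and equivariant because sums, multiples and images of
  elements of \<open>V\<close> stay in \<open>V\<close>. This closure comes from
  \<open>module_on act V\<close>; \<open>isomorphic_modules\<close> alone does not demand
  it.\<close>

lemma isomorphic_modules_sym:
  assumes "isomorphic_modules act V act' V'" and "module_on act V"
  shows "isomorphic_modules act' V' act V"
proof -
  obtain \<phi> where \<phi>: "bij_betw \<phi> V V'" "\<And>v w. v \<in> V \<Longrightarrow> w \<in> V \<Longrightarrow> \<phi> (v + w) = \<phi> v + \<phi> w"
     "\<And>c v. v \<in> V \<Longrightarrow> \<phi> (c *\<^sub>C v) = c *\<^sub>C \<phi> v" "\<And>x v. v \<in> V \<Longrightarrow> \<phi> (act x v) = act' x (\<phi> v)"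
    using assms(1) unfolding isomorphic_modules_def by blast
  have V: "csubspace V" "\<And>x v. v \<in> V \<Longrightarrow> act x v \<in> V" using assms(2) by (auto simp: module_on_def)
  let ?\<psi> = "the_inv_into V \<phi>"
  have inj: "inj_on \<phi> V" using \<phi>(1) by (simp add: bij_betw_def)
  have inv: "?\<psi> (\<phi> v) = v" if "v \<in> V" for v using the_inv_into_f_f[OF inj that] .
  have ex: "\<exists>v\<in>V. w = \<phi> v" if "w \<in> V'" for w using \<phi>(1) that by (auto simp: bij_betw_def)
  show ?thesis
    unfolding isomorphic_modules_def
  proof (intro exI[of _ ?\<psi>] conjI ballI allI)
    show "bij_betw ?\<psi> V' V" by (rule bij_betw_the_inv_into[OF \<phi>(1)])
    fix v' w' c x assume "v' \<in> V'"
    then obtain v where v: "v \<in> V" "v' = \<phi> v" using ex by blast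
    show "?\<psi> (c *\<^sub>C v') = c *\<^sub>C ?\<psi> v'"
      using v inv cvec.subspace_scale[OF V(1)] by (metis \<phi>(3))
    show "?\<psi> (act' x v') = act x (?\<psi> v')"
      using v inv V(2) by (metis \<phi>(4))
    assume "w' \<in> V'"
    then obtain w where w: "w \<in> V" "w' = \<phi> w" using ex by blast
    show "?\<psi> (v' + w') = ?\<psi> v' + ?\<psi> w'"
      using v w inv cvec.subspace_add[OF V(1)] by (metis \<phi>(2))
  qed
qed

section \<open>Abstract strings and their irreducibility\<close>

text \<open>The diagonal entry of \<open>B\<close> at the tensor of the basis vectors with indices
  \<open>k\<close> and \<open>d - k\<close> in the case \<open>m = d + e\<close>,
  \<open>n = d + f\<close>, \<open>l = d\<close>: half of the two Casimir eigenvalues plus half of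
  the eigenvalue of \<open>H\<close> tensor \<open>H\<close>. \<open>string_weight\<close> is the
  eigenvalue of \<open>A\<close> there.\<close>

definition string_diag :: "nat \<Rightarrow> nat \<Rightarrow> nat \<Rightarrow> nat \<Rightarrow> complex" where
  "string_diag d e f k =
     ((of_nat d + of_nat e) * (of_nat d + of_nat e + 2) + (of_nat d + of_nat f) * (of_nat d + of_nat f + 2)
      + 2 * (of_nat d + of_nat e - 2 * of_nat k) * (of_nat f - of_nat d + 2 * of_nat k)) / 4"

definition string_weight :: "nat \<Rightarrow> nat \<Rightarrow> nat \<Rightarrow> nat \<Rightarrow> complex" where
  "string_weight d e f k = (2 * of_nat d + of_nat e - of_nat f) / 4 - of_nat k"

lemma string_weight_inj: "string_weight d e f j = string_weight d e f k \<longleftrightarrow> j = k"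
  by (simp add: string_weight_def)

text \<open>The functionals \<open>co k\<close> are dual to \<open>U 0\<close>, ...,
  \<open>U d\<close> and so encode linear independence. The vector \<open>U (d + 1)\<close> and the
  truncated index at \<open>k = 0\<close> do no harm, since their coefficients in \<open>B\<close>
  and \<open>C\<close> are 0.\<close>

locale hahn_string =
  fixes act :: "hahn \<Rightarrow> 'v::complex_vector \<Rightarrow> 'v" and U :: "nat \<Rightarrow> 'v" and co :: "nat \<Rightarrow> 'v \<Rightarrow> complex"
    and d e f :: nat
  assumes module: "module_on act UNIV"
    and co: "clinear (co k)"
    and co_U: "j \<le> d \<Longrightarrow> k \<le> d \<Longrightarrow> co k (U j) = (if j = k then 1 else 0)"
    and A: "k \<le> d \<Longrightarrow> act (pgen gA) (U k) = string_weight d e f k *\<^sub>C U k"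
    and B: "k \<le> d \<Longrightarrow> act (pgen gB) (U k) = of_nat (k * (k + f)) *\<^sub>C U (k - 1)
      + string_diag d e f k *\<^sub>C U k + of_nat ((d - k) * (d + e - k)) *\<^sub>C U (k + 1)"
    and C: "k \<le> d \<Longrightarrow> act (pgen gC) (U k) = of_nat (k * (k + f)) *\<^sub>C U (k - 1)
      - of_nat ((d - k) * (d + e - k)) *\<^sub>C U (k + 1)"
begin

definition "V = cspan (U ` {..d})"

lemma U_in_V: "k \<le> d \<Longrightarrow> U k \<in> V"
  by (simp add: V_def cvec.span_base)

lemma V_subspace: "csubspace V"
  by (simp add: V_def)

lemma act_clinear: "clinear (act x)"
  using module by (simp add: module_on_def clinear_def)

lemma act_simps:
  "act (x + y) v = act x v + act y v" "act (c *\<^sub>C x) v = c *\<^sub>C act x v" "act 1 v = v"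
  "act (x * y) v = act x (act y v)"
  using module by (auto simp: module_on_def)

lemma V_expand:
  assumes "v \<in> V" shows "v = (\<Sum>k\<le>d. co k v *\<^sub>C U k)"
  using assms unfolding V_def
proof (induction rule: cvec.span_induct_alt)
  case base
  then show ?case by (simp add: clinear_zero[OF co])
next
  case (step c x y)
  then obtain j where j: "j \<le> d" "x = U j" by auto
  have "(\<Sum>k\<le>d. co k x *\<^sub>C U k) = x"
    using j by (simp add: co_U if_distrib[of "\<lambda>c. c *\<^sub>C _"] scaleC_one cong: if_cong)
  then show ?case
    using step.IH by (simp add: clinear_add[OF co] clinear_scale[OF co] scaleC_add_left sum.distrib
       scaleC_complex_def flip: scaleC_scaleC cvec.scale_sum_right)
qed

lemma V_eqI:
  assumes "v \<in> V" "w \<in> V" "\<And>k. k \<le> d \<Longrightarrow> co k v = co k w" shows "v = w"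
  using V_expand[OF assms(1)] V_expand[OF assms(2)] assms(3) by simp

lemma V_induct [consumes 1, case_names scale add]:
  assumes "v \<in> V" "\<And>c k. k \<le> d \<Longrightarrow> P (c *\<^sub>C U k)" "\<And>v w. v \<in> V \<Longrightarrow> w \<in> V \<Longrightarrow> P v \<Longrightarrow> P w \<Longrightarrow> P (v + w)"
  shows "P v"
proof -
  have "P (\<Sum>k\<le>j. co k v *\<^sub>C U k)" if "j \<le> d" for j
    using that
  proof (induction j)
    case (Suc j)
    then show ?case
      by (auto intro!: assms(2,3) cvec.subspace_sum[OF V_subspace] cvec.subspace_scale[OF V_subspace] U_in_V)
  qed (simp add: assms(2))
  then show ?thesis by (subst V_expand[OF assms(1)]) simp
qed

lemma gen_in_V: 
  assumes "v \<in> V" shows "act (pgen g) v \<in> V"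
  using assms
proof (induction rule: V_induct)
  case (scale c k)
  \<comment> \<open>At \<open>k = d\<close> the vector \<open>U (k + 1)\<close> may lie outside
    \<open>V\<close>, but its coefficient vanishes.\<close>
  have "of_nat ((d - k) * (d + e - k)) *\<^sub>C U (k + 1) \<in> V"
    by (cases "k = d") (use scale in \<open>auto intro!: cvec.subspace_scale[OF V_subspace] U_in_V cvec.subspace_0[OF V_subspace]\<close>)
  then have "act (pgen g) (U k) \<in> V"
    using scale by (cases g) (auto simp: A B C simp del: of_nat_mult
      intro!: cvec.subspace_scale[OF V_subspace] cvec.subspace_add[OF V_subspace] cvec.subspace_diff[OF V_subspace] U_in_V)
  then show ?case by (simp add: clinear_scale[OF act_clinear] cvec.subspace_scale[OF V_subspace])
next
  case (add v w)
  then show ?case by (simp add: clinear_add[OF act_clinear] cvec.subspace_add[OF V_subspace])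
qed

lemma act_in_V: "v \<in> V \<Longrightarrow> act x v \<in> V"
proof (induction x arbitrary: v rule: presented_induct)
qed (auto simp: act_simps gen_in_V intro: cvec.subspace_add[OF V_subspace] cvec.subspace_scale[OF V_subspace])

lemma module_V: "module_on act V"
  using module act_in_V V_subspace by (simp add: module_on_def)

lemma cdim_V: "cdim V = d + 1"
proof -
  have inj: "inj_on U {..d}"
    by (rule inj_onI) (metis atMost_iff co_U one_neq_zero)
  have ind: "\<not> cdependent (U ` {..d})"
  proof
    assume "cdependent (U ` {..d})"
    then obtain c where c: "(\<Sum>v\<in>U ` {..d}. c v *\<^sub>C v) = 0" "\<exists>v\<in>U ` {..d}. c v \<noteq> 0"
      using cvec.dependent_finite[of "U ` {..d}"] by auto
    then obtain k where k: "k \<le> d" "c (U k) \<noteq> 0" by auto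
    have "0 = co k (\<Sum>j\<le>d. c (U j) *\<^sub>C U j)"
      using c(1) by (simp add: sum.reindex[OF inj] clinear_zero[OF co])
    also have "\<dots> = (\<Sum>j\<le>d. if j = k then c (U j) else 0)"
      unfolding clinear_sum[OF co] clinear_scale[OF co]
      by (rule sum.cong) (auto simp: co_U k scaleC_complex_def)
    finally show False using k by simp
  qed
  show ?thesis
    unfolding V_def using cvec.dim_span_eq_card_independent[OF ind] card_image[OF inj] by simp
qed

text \<open>Separation of eigenvectors: \<open>A\<close> minus its eigenvalue at \<open>s\<close>
  kills the term of \<open>s\<close> and multiplies every other term by a nonzero number, because
  the weights are distinct. Induction on \<open>S\<close> then isolates each term.\<close>

lemma components_in_submodule:
  assumes W: "csubspace W" "\<And>v. v \<in> W \<Longrightarrow> act (pgen gA) v \<in> W"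
    and "finite S" "S \<subseteq> {..d}" "(\<Sum>k\<in>S. c k *\<^sub>C U k) \<in> W" "k \<in> S"
  shows "c k *\<^sub>C U k \<in> W"
  using assms(3-)
proof (induction S arbitrary: c k)
  case (insert s S)
  let ?a = "string_weight d e f"
  have *: "c k *\<^sub>C U k \<in> W" if "k \<in> S" for k
  proof -
    let ?w = "\<Sum>k\<in>insert s S. c k *\<^sub>C U k"
    have "act (pgen gA) ?w = (\<Sum>k\<in>insert s S. (c k * ?a k) *\<^sub>C U k)"
      unfolding clinear_sum[OF act_clinear] clinear_scale[OF act_clinear]
      by (rule sum.cong) (use insert.prems(1) in \<open>auto simp: A scaleC_scaleC\<close>)
    then have eq: "act (pgen gA) ?w - ?a s *\<^sub>C ?w = (\<Sum>k\<in>insert s S. (c k * (?a k - ?a s)) *\<^sub>C U k)"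
      by (simp add: cvec.scale_sum_right scaleC_scaleC algebra_simps flip: sum_subtractf del: sum.insert)
    have "act (pgen gA) ?w - ?a s *\<^sub>C ?w \<in> W"
      by (intro cvec.subspace_diff[OF W(1)] cvec.subspace_scale[OF W(1)] W(2) insert.prems(2))
    then have "(\<Sum>k\<in>S. (c k * (?a k - ?a s)) *\<^sub>C U k) \<in> W"
      unfolding eq using insert.hyps by simp
    then have "(c k * (?a k - ?a s)) *\<^sub>C U k \<in> W"
      using insert.IH that insert.prems(1) by simp
    then have "(1 / (?a k - ?a s)) *\<^sub>C (c k * (?a k - ?a s)) *\<^sub>C U k \<in> W"
      by (rule cvec.subspace_scale[OF W(1)])
    moreover have "?a k - ?a s \<noteq> 0" using that insert.hyps string_weight_inj[of d e f k s] by auto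
    ultimately show ?thesis by (simp add: scaleC_scaleC)
  qed
  show ?case
  proof (cases "k = s")
    case True
    have "(\<Sum>k\<in>insert s S. c k *\<^sub>C U k) - (\<Sum>k\<in>S. c k *\<^sub>C U k) \<in> W"
      by (intro cvec.subspace_diff[OF W(1)] cvec.subspace_sum[OF W(1)] insert.prems(2) *)
    then show ?thesis using True insert.hyps by simp
  qed (use * insert.prems in simp)
qed simp

text \<open>A nonzero submodule contains a nonzero component of one of its vectors, hence some
  \<open>U k\<close>. Applying \<open>C\<close> to \<open>U j\<close> and separating components
  yields both neighbours of \<open>U j\<close>, so the submodule spreads along the whole
  string.\<close>

lemma irreducible_V: "irreducible_module act V"
  unfolding irreducible_module_def
proof (intro conjI allI impI module_V)
  show "V \<noteq> {0}" using U_in_V[of 0] co_U[of 0 0] clinear_zero[OF co, of 0] by auto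
  fix W assume "W \<subseteq> V \<and> module_on act W"
  then have W: "W \<subseteq> V" "csubspace W" "\<And>x v. v \<in> W \<Longrightarrow> act x v \<in> W"
    by (auto simp: module_on_def)
  have scale: "v \<in> W" if "c *\<^sub>C v \<in> W" "c \<noteq> 0" for c v
    using cvec.subspace_scale[OF W(2) that(1), of "1 / c"] that(2) by (simp add: scaleC_scaleC scaleC_one)
  show "W = {0} \<or> W = V"
  proof (rule disjCI)
    assume "W \<noteq> V"
    show "W = {0}"
    proof (rule ccontr)
      assume "W \<noteq> {0}"
      then obtain w where w: "w \<in> W" "w \<noteq> 0" using cvec.subspace_0[OF W(2)] by auto
      have "\<exists>k\<le>d. co k w \<noteq> 0"
        using V_eqI[of w 0] w W(1) clinear_zero[OF co] cvec.subspace_0[OF V_subspace] by auto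
      then obtain k where k: "k \<le> d" "co k w \<noteq> 0" by blast
      have "co k w *\<^sub>C U k \<in> W"
        by (rule components_in_submodule[OF W(2,3), of "{..d}" "\<lambda>k. co k w"])
          (use V_expand[of w] w W(1) k in auto)
      then have Uk: "U k \<in> W" using scale k by blast
      have C_neighbours: "(j > 0 \<longrightarrow> U (j - 1) \<in> W) \<and> (j < d \<longrightarrow> U (j + 1) \<in> W)"
        if j: "U j \<in> W" "j \<le> d" for j
      proof -
        \<comment> \<open>\<open>C\<close> applied to \<open>U j\<close>, written as a sum over
          those neighbours of \<open>j\<close> that exist, so that
          \<open>components_in_submodule\<close> applies also at the two ends of the string. On
          \<open>?S\<close> all coefficients \<open>?c i\<close> are nonzero.\<close>
        let ?c = "\<lambda>i. if i + 1 = j then of_nat (j * (j + f)) else - of_nat ((d - j) * (d + e - j)) :: complex"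
        let ?S = "(if j > 0 then {j - 1} else {}) \<union> (if j < d then {j + 1} else {})"
        have "(\<Sum>i\<in>?S. ?c i *\<^sub>C U i) = act (pgen gC) (U j)"
          using j(2) by (cases "j = 0"; cases "j = d") (auto simp: C simp del: of_nat_mult)
        then have "(\<Sum>i\<in>?S. ?c i *\<^sub>C U i) \<in> W" using W(3) j(1) by simp
        then have *: "?c i *\<^sub>C U i \<in> W" if "i \<in> ?S" for i
          by (rule components_in_submodule[OF W(2,3), rotated -2]) (use that j(2) in \<open>auto split: if_splits\<close>)
        show ?thesis
        proof (intro conjI impI)
          assume "j > 0" then show "U (j - 1) \<in> W"
            using scale[OF *[of "j - 1"]] by (simp del: of_nat_add)
        next
          assume "j < d" then show "U (j + 1) \<in> W"
            using scale[OF *[of "j + 1"]] by (simp del: of_nat_add)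
        qed
      qed
      have down: "i \<le> k \<Longrightarrow> U (k - i) \<in> W" for i
      proof (induction i)
        case (Suc i)
        then show ?case using C_neighbours[of "k - i"] k(1) by simp
      qed (simp add: Uk)
      have up: "k + i \<le> d \<Longrightarrow> U (k + i) \<in> W" for i
      proof (induction i)
        case (Suc i)
        then show ?case using C_neighbours[of "k + i"] by simp
      qed (simp add: Uk)
      have "U i \<in> W" if "i \<le> d" for i
        using down[of "k - i"] up[of "i - k"] that by (cases "i \<le> k") auto
      then have "V \<subseteq> W" unfolding V_def by (intro cvec.span_minimal W(2)) auto
      with W(1) \<open>W \<noteq> V\<close> show False by blast
    qed
  qed
qed

end

section \<open>Isomorphism classes of strings\<close>

text \<open>The map sending \<open>U k\<close> to \<open>U' k\<close> commutes with the generators,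
  since their matrices are determined by \<open>d\<close>, \<open>e\<close>, \<open>f\<close>, and
  hence with all of \<open>hahn\<close>.\<close>

lemma hahn_string_isomorphic:
  assumes "hahn_string act U co d e f" and "hahn_string act' U' co' d e f"
  shows "isomorphic_modules act (hahn_string.V U d) act' (hahn_string.V U' d)"
proof -
  interpret S: hahn_string act U co d e f by fact
  interpret S': hahn_string act' U' co' d e f by fact
  \<comment> \<open>Defined through coordinates on the whole ambient space, so that \<phi> is linear
    everywhere and not only on \<open>S.V\<close>.\<close>
  define \<phi> where "\<phi> v = (\<Sum>k\<le>d. co k v *\<^sub>C U' k)" for v
  have lin: "clinear \<phi>"
    by (rule clinearI)
      (simp_all add: \<phi>_def clinear_add[OF S.co] clinear_scale[OF S.co] scaleC_add_left sum.distrib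
       scaleC_complex_def cvec.scale_sum_right scaleC_scaleC)
  have \<phi>U: "\<phi> (U k) = U' k" if "k \<le> d" for k
  proof -
    have "\<phi> (U k) = (\<Sum>j\<le>d. if j = k then U' j else 0)"
      unfolding \<phi>_def by (rule sum.cong) (use that in \<open>auto simp: S.co_U scaleC_one\<close>)
    then show ?thesis using that by simp
  qed
  have co\<phi>: "co' k (\<phi> v) = co k v" if "k \<le> d" for k v
  proof -
    have "co' k (\<phi> v) = (\<Sum>j\<le>d. if j = k then co j v else 0)"
      unfolding \<phi>_def clinear_sum[OF S'.co] clinear_scale[OF S'.co]
      by (rule sum.cong) (use that in \<open>auto simp: S'.co_U scaleC_complex_def\<close>)
    then show ?thesis using that by simp
  qed
  have in_V: "\<phi> v \<in> S'.V" for v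
    unfolding \<phi>_def by (intro cvec.subspace_sum[OF S'.V_subspace] cvec.subspace_scale[OF S'.V_subspace]) (auto intro: S'.U_in_V)
  have gen: "\<phi> (act (pgen g) v) = act' (pgen g) (\<phi> v)" if "v \<in> S.V" for v g
    using that
  proof (induction rule: S.V_induct)
    case (scale c k)
    \<comment> \<open>Beyond the end of the string \<phi> need not match \<open>U\<close> with
      \<open>U'\<close>; there both sides are 0.\<close>
    have "of_nat ((d - k) * (d + e - k)) *\<^sub>C \<phi> (U (k + 1)) = of_nat ((d - k) * (d + e - k)) *\<^sub>C U' (k + 1)"
      using scale by (cases "k = d") (auto simp: \<phi>U)
    then have "\<phi> (act (pgen g) (U k)) = act' (pgen g) (U' k)"
      using scale by (cases g) (simp_all add: S.A S.B S.C S'.A S'.B S'.C clinear_add[OF lin] clinear_diff[OF lin]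
        clinear_scale[OF lin] \<phi>U del: of_nat_mult)
    then show ?case
      using scale by (simp add: clinear_scale[OF lin] clinear_scale[OF S.act_clinear] clinear_scale[OF S'.act_clinear] \<phi>U)
  next
    case (add v w)
    then show ?case by (simp add: clinear_add[OF lin] clinear_add[OF S.act_clinear] clinear_add[OF S'.act_clinear])
  qed
  have act: "\<phi> (act x v) = act' x (\<phi> v)" if "v \<in> S.V" for v x
    using that
  proof (induction x arbitrary: v rule: presented_induct)
  qed (auto simp: S.act_simps S'.act_simps gen S.act_in_V clinear_add[OF lin] clinear_scale[OF lin])
  have "bij_betw \<phi> S.V S'.V"
  proof (rule bij_betwI')
    show "(\<phi> v = \<phi> w) = (v = w)" if "v \<in> S.V" "w \<in> S.V" for v w
      using that S.V_eqI co\<phi> by metis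
    show "\<exists>v\<in>S.V. w = \<phi> v" if w: "w \<in> S'.V" for w
      using w
    proof (induction rule: S'.V_induct)
      case (scale c k)
      then show ?case
        by (intro bexI[of _ "c *\<^sub>C U k"]) (auto simp: clinear_scale[OF lin] \<phi>U
          intro: cvec.subspace_scale[OF S.V_subspace] S.U_in_V)
    next
      case (add v w)
      then obtain v' w' where "v' \<in> S.V" "v = \<phi> v'" "w' \<in> S.V" "w = \<phi> w'" by blast
      then show ?case by (intro bexI[of _ "v' + w'"]) (auto simp: clinear_add[OF lin] 
          intro: cvec.subspace_add[OF S.V_subspace])
    qed
  qed (rule in_V)
  then show ?thesis
    unfolding isomorphic_modules_def
    by (intro exI[of _ \<phi>]) (simp add: act clinear_add[OF lin] clinear_scale[OF lin])
qed

text \<open>The image of \<open>U k\<close> is an eigenvector of \<open>A\<close> in the second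
  string, so \<open>co' j\<close> of the eigenvalue equation leaves a nonzero coordinate times the
  difference of the two weights.\<close>

lemma hahn_string_hom_eigenvector:
  assumes "hahn_string act U co d e f" and "hahn_string act' U' co' d' e' f'"
    and V': "\<phi> (U k) \<in> hahn_string.V U' d'"
    and scale: "\<And>c. \<phi> (c *\<^sub>C U k) = c *\<^sub>C \<phi> (U k)"
    and act: "\<phi> (act (pgen gA) (U k)) = act' (pgen gA) (\<phi> (U k))"
    and k: "k \<le> d" and j: "j \<le> d'" "co' j (\<phi> (U k)) \<noteq> 0"
  shows "string_weight d e f k = string_weight d' e' f' j"
proof -
  interpret S: hahn_string act U co d e f by fact
  interpret S': hahn_string act' U' co' d' e' f' by fact
  let ?w = "\<phi> (U k)"
  have "string_weight d e f k *\<^sub>C ?w = act' (pgen gA) (\<Sum>j\<le>d'. co' j ?w *\<^sub>C U' j)"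
    using S'.V_expand[OF V'] act by (simp add: S.A k scale)
  also have "\<dots> = (\<Sum>j\<le>d'. (co' j ?w * string_weight d' e' f' j) *\<^sub>C U' j)"
    unfolding clinear_sum[OF S'.act_clinear] clinear_scale[OF S'.act_clinear]
    by (rule sum.cong) (auto simp: S'.A scaleC_scaleC)
  finally have "co' j (string_weight d e f k *\<^sub>C ?w) = co' j (\<Sum>j\<le>d'. (co' j ?w * string_weight d' e' f' j) *\<^sub>C U' j)"
    by simp
  also have "\<dots> = (\<Sum>i\<le>d'. if i = j then co' j ?w * string_weight d' e' f' j else 0)"
    unfolding clinear_sum[OF S'.co] clinear_scale[OF S'.co]
    by (rule sum.cong) (use j in \<open>auto simp: S'.co_U scaleC_complex_def\<close>)
  finally show ?thesis using j by (simp add: clinear_scale[OF S'.co] scaleC_complex_def)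
qed

text \<open>The two invariants that tell strings apart. If the weights at 0 agree, simplicity of the
  spectrum makes the image of \<open>U 0\<close> a nonzero multiple of \<open>U' 0\<close>. The
  image of \<open>U 1\<close> has a different weight, so comparing the coefficients of
  \<open>U' 0\<close> in the images of \<open>B\<close> leaves only the diagonal entries.\<close>

lemma
  assumes "hahn_string act U co d e f" and "hahn_string act' U' co' d' e' f'"
    and iso: "isomorphic_modules act (hahn_string.V U d) act' (hahn_string.V U' d')"
  shows hahn_string_isomorphic_weight:
      "k \<le> d \<Longrightarrow> \<exists>j\<le>d'. string_weight d e f k = string_weight d' e' f' j"
    and hahn_string_isomorphic_diag: "string_weight d e f 0 = string_weight d' e' f' 0 \<Longrightarrow>
      string_diag d e f 0 = string_diag d' e' f' 0"
proof -
  interpret S: hahn_string act U co d e f by fact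
  interpret S': hahn_string act' U' co' d' e' f' by fact
  obtain \<phi> where bij: "bij_betw \<phi> S.V S'.V"
    and add: "\<And>v w. v \<in> S.V \<Longrightarrow> w \<in> S.V \<Longrightarrow> \<phi> (v + w) = \<phi> v + \<phi> w"
    and scale: "\<And>c v. v \<in> S.V \<Longrightarrow> \<phi> (c *\<^sub>C v) = c *\<^sub>C \<phi> v"
    and act: "\<And>x v. v \<in> S.V \<Longrightarrow> \<phi> (act x v) = act' x (\<phi> v)"
    using iso unfolding isomorphic_modules_def by blast
  have \<phi>V: "\<phi> v \<in> S'.V" if "v \<in> S.V" for v using bij that by (auto simp: bij_betw_def)
  have eig: "string_weight d e f k = string_weight d' e' f' j"
    if "k \<le> d" "j \<le> d'" "co' j (\<phi> (U k)) \<noteq> 0" for j k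
    by (rule hahn_string_hom_eigenvector[OF assms(1,2), where \<phi> = \<phi>])
      (use that in \<open>simp_all add: S.U_in_V \<phi>V scale act\<close>)
  have zero: "\<phi> 0 = 0"
    using scale[of 0 0] cvec.subspace_0[OF S.V_subspace] by simp
  have ex: "\<exists>j\<le>d'. co' j (\<phi> (U k)) \<noteq> 0" if "k \<le> d" for k
  proof (rule ccontr)
    assume "\<not> ?thesis"
    then have "\<phi> (U k) = 0" using S'.V_expand[OF \<phi>V[OF S.U_in_V[OF that]]] by simp
    then have "U k = 0"
      using bij S.U_in_V[OF that] zero cvec.subspace_0[OF S.V_subspace]
      by (metis bij_betw_def inj_onD)
    then show False using S.co_U[OF that that] clinear_zero[OF S.co] by simp
  qed
  show "\<exists>j\<le>d'. string_weight d e f k = string_weight d' e' f' j" if "k \<le> d"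
    using ex[OF that] eig[OF that] by blast
  assume w0: "string_weight d e f 0 = string_weight d' e' f' 0"
  have only0: "j = 0" if "j \<le> d'" "co' j (\<phi> (U 0)) \<noteq> 0" for j
    using eig[of 0 j] that w0 string_weight_inj by (metis zero_le)
  define c where "c = co' 0 (\<phi> (U 0))"
  have c: "c \<noteq> 0" using ex[of 0] only0 unfolding c_def by auto
  have \<phi>0: "\<phi> (U 0) = c *\<^sub>C U' 0"
  proof (rule S'.V_eqI)
    show "co' k (\<phi> (U 0)) = co' k (c *\<^sub>C U' 0)" if "k \<le> d'" for k
      using that only0[of k] by (auto simp: clinear_scale[OF S'.co] S'.co_U scaleC_complex_def c_def)
  qed (auto simp: \<phi>V S.U_in_V S'.U_in_V cvec.subspace_scale[OF S'.V_subspace])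
  \<comment> \<open>The coefficient of \<open>U 1\<close> in \<open>B\<close> applied to
    \<open>U 0\<close>. It is 0 for \<open>d = 0\<close>, when \<open>U 1\<close> is not part of the
    string.\<close>
  let ?y = "of_nat ((d - 0) * (d + e - 0)) :: complex"
  let ?y' = "of_nat ((d' - 0) * (d' + e' - 0)) :: complex"
  have y: "?y *\<^sub>C U 1 \<in> S.V \<and> co' 0 (\<phi> (?y *\<^sub>C U 1)) = 0"
  proof (cases "d = 0")
    case True
    then show ?thesis using cvec.subspace_0[OF S.V_subspace] by (simp add: zero clinear_zero[OF S'.co])
  next
    case False
    then have "co' 0 (\<phi> (U 1)) = 0"
      using eig[of 1 0] w0 string_weight_inj[of d e f 1 0] by auto
    then show ?thesis
      using False by (simp add: scale S.U_in_V clinear_scale[OF S'.co] cvec.subspace_scale[OF S.V_subspace]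
        scaleC_complex_def del: of_nat_mult)
  qed
  have y': "co' 0 (?y' *\<^sub>C U' 1) = 0"
    by (cases "d' = 0") (auto simp: clinear_scale[OF S'.co] clinear_zero[OF S'.co] S'.co_U scaleC_complex_def)
  have "\<phi> (act (pgen gB) (U 0)) = string_diag d e f 0 *\<^sub>C \<phi> (U 0) + \<phi> (?y *\<^sub>C U 1)"
    using y by (simp add: S.B add scale S.U_in_V cvec.subspace_scale[OF S.V_subspace] del: of_nat_mult)
  then have "co' 0 (\<phi> (act (pgen gB) (U 0))) = string_diag d e f 0 * c"
    using y by (simp add: clinear_add[OF S'.co] clinear_scale[OF S'.co] scaleC_complex_def c_def)
  moreover have "co' 0 (act' (pgen gB) (\<phi> (U 0))) = c * string_diag d' e' f' 0"
    using y' by (simp add: \<phi>0 clinear_scale[OF S'.act_clinear] S'.B clinear_add[OF S'.co]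
      clinear_scale[OF S'.co] S'.co_U scaleC_complex_def del: of_nat_mult)
  ultimately show "string_diag d e f 0 = string_diag d' e' f' 0"
    using c act[OF S.U_in_V[of 0]] by simp
qed

lemma string_weight_eq_iff:
  "string_weight d e f k = string_weight d' e' f' j \<longleftrightarrow>
    2 * int d + int e - int f - 4 * int k = 2 * int d' + int e' - int f' - 4 * int j"
proof -
  have "string_weight d e f k = of_int (2 * int d + int e - int f - 4 * int k) / 4" for d e f k
    by (simp add: string_weight_def field_simps)
  then show ?thesis by (simp only: divide_cancel_right of_int_eq_iff) simp
qed

text \<open>At \<open>k = 0\<close> the negative terms cancel, which turns the comparison into one
  of natural numbers, where monotonicity is available.\<close>

lemma string_diag_zero_eq_iff:
  "string_diag d e f 0 = string_diag d e' f' 0 \<longleftrightarrow>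
    (e + f) ^ 2 + 2 * (e + f) + 4 * d * f = (e' + f') ^ 2 + 2 * (e' + f') + 4 * d * f'"
proof -
  have "string_diag d e f 0 = (of_nat ((e + f) ^ 2 + 2 * (e + f) + 4 * d * f) + 4 * of_nat d) / 4" for e f
    by (simp add: string_diag_def field_simps power2_eq_square)
  then show ?thesis by (simp only: divide_cancel_right add_right_cancel of_nat_eq_iff) simp
qed

lemma hahn_string_isomorphic_iff:
  assumes S: "hahn_string act U co d e f" and S': "hahn_string act' U' co' d' e' f'"
  shows "isomorphic_modules act (hahn_string.V U d) act' (hahn_string.V U' d') \<longleftrightarrow>
    d = d' \<and> e = e' \<and> f = f'"
proof
  assume iso: "isomorphic_modules act (hahn_string.V U d) act' (hahn_string.V U' d')"
  note iso' = isomorphic_modules_sym[OF iso hahn_string.module_V[OF S]]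
  note w = hahn_string_isomorphic_weight[OF S S' iso, unfolded string_weight_eq_iff]
  note w' = hahn_string_isomorphic_weight[OF S' S iso', unfolded string_weight_eq_iff]
  \<comment> \<open>The weight of index 0 is the largest in each string and occurs in the other, so
    the two are equal. Comparing the smallest weights, at \<open>k = d\<close> and
    \<open>k = d'\<close>, then gives \<open>d = d'\<close>.\<close>
  have top: "2 * int d + int e - int f = 2 * int d' + int e' - int f'"
    using w[of 0] w'[of 0] by auto
  then have d: "d = d'" using w[of d] w'[of d'] by auto
  have "string_diag d e f 0 = string_diag d' e' f' 0"
    using hahn_string_isomorphic_diag[OF S S' iso] top by (simp add: string_weight_eq_iff)
  then have q: "(e + f) ^ 2 + 2 * (e + f) + 4 * d * f = (e' + f') ^ 2 + 2 * (e' + f') + 4 * d * f'"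
    using d string_diag_zero_eq_iff by simp
  \<comment> \<open>With \<open>e - f\<close> fixed, a larger \<open>f\<close> means a larger
    \<open>e + f\<close>, and the expression strictly increases.\<close>
  have less: False
    if "f1 < f2" "int e1 - int f1 = int e2 - int f2"
      "(e1 + f1) ^ 2 + 2 * (e1 + f1) + 4 * d * f1 = (e2 + f2) ^ 2 + 2 * (e2 + f2) + 4 * d * f2"
    for e1 f1 e2 f2 :: nat
  proof -
    have "e1 + f1 < e2 + f2" using that(1,2) by linarith
    then have "(e1 + f1) ^ 2 + 2 * (e1 + f1) + 4 * d * f1 < (e2 + f2) ^ 2 + 2 * (e2 + f2) + 4 * d * f2"
      using that(1) by (intro add_less_le_mono add_le_less_mono power_mono) auto
    then show False using that(3) by simp
  qed
  have "f = f'" using less[of f f' e e'] less[of f' f e' e] q top d by (cases f f' rule: linorder_cases) auto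
  then show "d = d' \<and> e = e' \<and> f = f'" using top d by auto
next
  assume "d = d' \<and> e = e' \<and> f = f'"
  then show "isomorphic_modules act (hahn_string.V U d) act' (hahn_string.V U' d')"
    using hahn_string_isomorphic[OF S] S' by simp
qed

section \<open>Coordinates on the tensor product and the action of the generators\<close>

definition vbasis :: "nat \<Rightarrow> nat \<Rightarrow>\<^sub>0 complex" where
  "vbasis i = Poly_Mapping.single i 1"

definition tbasis :: "nat \<Rightarrow> nat \<Rightarrow> (nat \<Rightarrow>\<^sub>0 complex, nat \<Rightarrow>\<^sub>0 complex) tensor" where
  "tbasis i j = vbasis i \<otimes> vbasis j"

text \<open>The functionals dual to \<open>tbasis\<close>. The tensor product being a quotient, they
  are what shows that the vectors \<open>tbasis i j\<close> are linearly independent.\<close>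

definition tcoord :: "nat \<Rightarrow> nat \<Rightarrow> (nat \<Rightarrow>\<^sub>0 complex, nat \<Rightarrow>\<^sub>0 complex) tensor \<Rightarrow> complex" where
  "tcoord i j = tensor_lift (\<lambda>v w. Poly_Mapping.lookup v i * Poly_Mapping.lookup w j)"

lemma tcoord_clinear: "clinear (tcoord i j)"
  and tcoord_tensor: "tcoord i j (v \<otimes> w) = Poly_Mapping.lookup v i * Poly_Mapping.lookup w j"
proof -
  have "cbilinear (\<lambda>v w. Poly_Mapping.lookup v i * Poly_Mapping.lookup w j :: complex)"
    by (simp add: cbilinear_def clinear_def lookup_add lookup_scaleC scaleC_complex_def algebra_simps)
  from tensor_lift_bilinear[OF this]
  show "clinear (tcoord i j)" "tcoord i j (v \<otimes> w) = Poly_Mapping.lookup v i * Poly_Mapping.lookup w j"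
    by (simp_all add: tcoord_def)
qed

lemma tcoord_tbasis: "tcoord i j (tbasis i' j') = (if i = i' \<and> j = j' then 1 else 0)"
  by (auto simp: tbasis_def tcoord_tensor vbasis_def lookup_single when_def)

lemma L_eq: "L n = cspan (vbasis ` {..n})"
  unfolding L_def vbasis_def by (rule arg_cong[of _ _ cspan]) auto

text \<open>For \<open>i \<le> n\<close> the case distinctions of \<open>L_gen\<close> disappear:
  the scalar is 0 for \<open>E\<close> at \<open>i = 0\<close> and for \<open>F\<close> at
  \<open>i = n\<close>.\<close>

lemma L_act_gen_vbasis:
  assumes "i \<le> n"
  shows "L_act n E (vbasis i) = of_nat i *\<^sub>C vbasis (i - 1)"
    and "L_act n F (vbasis i) = of_nat (n - i) *\<^sub>C vbasis (i + 1)"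
    and "L_act n H (vbasis i) = (of_nat n - 2 * of_nat i) *\<^sub>C vbasis i"
  using assms unfolding vbasis_def L_act_gen
  by (auto simp: of_nat_diff simp del: single_one)

lemma L_act_simps:
  "L_act n (x + y) v = L_act n x v + L_act n y v" "L_act n (c *\<^sub>C x) v = c *\<^sub>C L_act n x v"
  "L_act n 1 v = v" "L_act n (x * y) v = L_act n x (L_act n y v)"
  "L_act n x (v + w) = L_act n x v + L_act n x w" "L_act n x (c *\<^sub>C v) = c *\<^sub>C L_act n x v"
  "L_act n x 0 = 0"
proof -
  show scale: "L_act n x (c *\<^sub>C v) = c *\<^sub>C L_act n x v" for c v
    using L_act_module[of n] by (auto simp: module_on_def)
  show "L_act n x 0 = 0" using scale[of 0 0] by simp
qed (use L_act_module[of n] in \<open>auto simp: module_on_def\<close>)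

lemma L_act_casimir:
  assumes "i \<le> n"
  shows "L_act n casimir (vbasis i) = (of_nat n * (of_nat n + 2) / 2) *\<^sub>C vbasis i"
proof -
  have EF: "L_act n E (L_act n F (vbasis i)) = of_nat ((n - i) * (i + 1)) *\<^sub>C vbasis i"
  proof (cases "i = n")
    case False
    with assms have "i + 1 \<le> n" by simp
    then show ?thesis
      using assms by (simp only: L_act_gen_vbasis L_act_simps scaleC_scaleC of_nat_mult add_diff_cancel_right')
  qed (simp add: L_act_gen_vbasis L_act_simps)
  have FE: "L_act n F (L_act n E (vbasis i)) = of_nat (i * (n - i + 1)) *\<^sub>C vbasis i"
  proof (cases "i = 0")
    case False
    with assms have "i - 1 \<le> n" "n - (i - 1) = n - i + 1" "i - 1 + 1 = i" by simp_all
    then show ?thesis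
      using assms by (simp only: L_act_gen_vbasis L_act_simps scaleC_scaleC of_nat_mult)
  qed (use assms in \<open>simp add: L_act_gen_vbasis L_act_simps\<close>)
  have "L_act n casimir (vbasis i) =
      (of_nat ((n - i) * (i + 1)) + of_nat (i * (n - i + 1)) + (of_nat n - 2 * of_nat i) ^ 2 / 2) *\<^sub>C vbasis i"
    using assms by (simp only: casimir_def power2_eq_square L_act_simps EF FE L_act_gen_vbasis(3)
        scaleC_scaleC scaleC_add_left) simp
  also have "(of_nat ((n - i) * (i + 1)) + of_nat (i * (n - i + 1)) + (of_nat n - 2 * of_nat i) ^ 2 / 2 :: complex)
      = of_nat n * (of_nat n + 2) / 2"
    using assms by (simp add: of_nat_diff power2_eq_square field_simps)
  finally show ?thesis .
qed

lemma LL_act_module: "module_on (LL_act m n) UNIV"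
  unfolding LL_act_def by (intro tensor_act_module L_act_module)

lemma LL_act_tensor: "LL_act m n (x \<otimes> y) (v \<otimes> w) = L_act m x v \<otimes> L_act n y w"
  unfolding LL_act_def by (intro tensor_act_tensor L_act_module)

lemma LL_act_clinear: "clinear (LL_act m n x)"
  using LL_act_module[of m n] by (simp add: module_on_def clinear_def)

lemma LL_act_simps:
  "LL_act m n (x + y) v = LL_act m n x v + LL_act m n y v" "LL_act m n (c *\<^sub>C x) v = c *\<^sub>C LL_act m n x v"
  "LL_act m n (x - y) v = LL_act m n x v - LL_act m n y v"
proof -
  have "clinear (\<lambda>x. LL_act m n x v)" using LL_act_module[of m n] by (simp add: module_on_def clinear_def)
  then show "LL_act m n (x + y) v = LL_act m n x v + LL_act m n y v"
    "LL_act m n (c *\<^sub>C x) v = c *\<^sub>C LL_act m n x v"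
    "LL_act m n (x - y) v = LL_act m n x v - LL_act m n y v"
    by (rule clinear_add clinear_scale clinear_diff)+
qed

lemma LL_act_comult_H:
  assumes "i \<le> m" "j \<le> n"
  shows "LL_act m n (comult H) (tbasis i j) = (of_nat m + of_nat n - 2 * of_nat (i + j)) *\<^sub>C tbasis i j"
  using assms
  by (simp add: comult_hom LL_act_simps tbasis_def LL_act_tensor L_act_gen_vbasis L_act_simps tensor_simps
      flip: scaleC_add_left)

text \<open>The mixed terms of the expanded products: \<open>E \<otimes> F\<close> and
  \<open>F \<otimes> E\<close> arise twice each, \<open>H \<otimes> H\<close> twice with factor 1/2.
  On \<open>LL m n\<close> the two Casimir terms act as scalars.\<close>

lemma comult_casimir:
  "comult casimir = casimir \<otimes> 1 + 1 \<otimes> casimir + 2 *\<^sub>C (E \<otimes> F) + 2 *\<^sub>C (F \<otimes> E) + H \<otimes> H"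
proof -
  have two: "2 *\<^sub>C x = x + x" for x :: usl2_2
    using scaleC_add_left[of 1 1 x] by (simp add: scaleC_one)
  have half: "x = (1/2) *\<^sub>C x + (1/2) *\<^sub>C x" for x :: usl2_2
    using scaleC_add_left[of "1/2" "1/2" x] by (simp add: scaleC_one)
  note c = comult_hom(1)
  have "comult casimir = (comult E * comult F + comult F * comult E) + (1/2) *\<^sub>C (comult H * comult H)"
    by (simp add: casimir_def power2_eq_square clinear_add[OF algebra_hom_clinear[OF c]]
        clinear_scale[OF algebra_hom_clinear[OF c]] algebra_hom_mult[OF c])
  also have "\<dots> = casimir \<otimes> 1 + 1 \<otimes> casimir + 2 *\<^sub>C (E \<otimes> F) + 2 *\<^sub>C (F \<otimes> E)
      + ((1/2) *\<^sub>C (H \<otimes> H) + (1/2) *\<^sub>C (H \<otimes> H))"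
    by (simp add: casimir_def power2_eq_square comult_hom(2) tensor_mult tensor_simps two
        distrib_left distrib_right scaleC_add_right del: cvec.scale_left_distrib)
  finally show ?thesis by (simp flip: half)
qed

lemma hahn_act_gen: "hahn_act m n (pgen g) = LL_act m n (natural_gen g)"
  by (simp add: hahn_act_def pullback_def natural_hom fun_eq_iff)

lemma hahn_act_module: "module_on (hahn_act m n) UNIV"
  using LL_act_module[of m n] natural_hom(1)
  by (simp add: module_on_def hahn_act_def pullback_def algebra_hom_def clinear_def)

text \<open>\<open>E \<otimes> F\<close> and \<open>F \<otimes> E\<close> shift the two indices in
  opposite directions and preserve \<open>i + j\<close>. Whenever a shifted index leaves its range
  or is truncated at 0, its coefficient is 0.\<close>

lemma hahn_act_tbasis:
  assumes "i \<le> m" "j \<le> n"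
  shows "hahn_act m n (pgen gA) (tbasis i j) =
      ((of_nat m - 2 * of_nat i - of_nat n + 2 * of_nat j) / 4) *\<^sub>C tbasis i j"
    and "hahn_act m n (pgen gB) (tbasis i j) =
      of_nat (i * (n - j)) *\<^sub>C tbasis (i - 1) (j + 1)
      + ((of_nat m * (of_nat m + 2) + of_nat n * (of_nat n + 2)
         + 2 * (of_nat m - 2 * of_nat i) * (of_nat n - 2 * of_nat j)) / 4) *\<^sub>C tbasis i j
      + of_nat ((m - i) * j) *\<^sub>C tbasis (i + 1) (j - 1)"
    and "hahn_act m n (pgen gC) (tbasis i j) =
      of_nat (i * (n - j)) *\<^sub>C tbasis (i - 1) (j + 1) - of_nat ((m - i) * j) *\<^sub>C tbasis (i + 1) (j - 1)"
proof -
  note s = hahn_act_gen LL_act_simps tbasis_def LL_act_tensor L_act_gen_vbasis assms L_act_simps tensor_simps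
    scaleC_scaleC
  show "hahn_act m n (pgen gA) (tbasis i j) =
      ((of_nat m - 2 * of_nat i - of_nat n + 2 * of_nat j) / 4) *\<^sub>C tbasis i j"
    by (simp add: s flip: cvec.scale_left_diff_distrib)
  show "hahn_act m n (pgen gC) (tbasis i j) =
      of_nat (i * (n - j)) *\<^sub>C tbasis (i - 1) (j + 1) - of_nat ((m - i) * j) *\<^sub>C tbasis (i + 1) (j - 1)"
    by (simp add: s mult.commute)
  have "hahn_act m n (pgen gB) (tbasis i j) =
      of_nat (i * (n - j)) *\<^sub>C tbasis (i - 1) (j + 1)
      + ((of_nat m * (of_nat m + 2) / 4) *\<^sub>C tbasis i j + (of_nat n * (of_nat n + 2) / 4) *\<^sub>C tbasis i j
         + ((of_nat m - 2 * of_nat i) * (of_nat n - 2 * of_nat j) / 2) *\<^sub>C tbasis i j)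
      + of_nat ((m - i) * j) *\<^sub>C tbasis (i + 1) (j - 1)"
    by (simp add: s comult_casimir L_act_casimir scaleC_add_right mult.commute add.assoc add.left_commute add.commute)
  also have "(of_nat m * (of_nat m + 2) / 4) *\<^sub>C tbasis i j + (of_nat n * (of_nat n + 2) / 4) *\<^sub>C tbasis i j
         + ((of_nat m - 2 * of_nat i) * (of_nat n - 2 * of_nat j) / 2) *\<^sub>C tbasis i j
      = ((of_nat m * (of_nat m + 2) + of_nat n * (of_nat n + 2)
         + 2 * (of_nat m - 2 * of_nat i) * (of_nat n - 2 * of_nat j)) / 4) *\<^sub>C tbasis i j"
    unfolding scaleC_add_left[symmetric] by (simp add: add_divide_distrib)
  finally show "hahn_act m n (pgen gB) (tbasis i j) =
      of_nat (i * (n - j)) *\<^sub>C tbasis (i - 1) (j + 1)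
      + ((of_nat m * (of_nat m + 2) + of_nat n * (of_nat n + 2)
         + 2 * (of_nat m - 2 * of_nat i) * (of_nat n - 2 * of_nat j)) / 4) *\<^sub>C tbasis i j
      + of_nat ((m - i) * j) *\<^sub>C tbasis (i + 1) (j - 1)" .
qed

lemma LL_eq: "LL m n = cspan (\<Union>i\<le>m. tbasis i ` {..n})"
proof
  let ?T = "\<Union>i\<le>m. tbasis i ` {..n}"
  have "vbasis i \<otimes> w \<in> cspan ?T" if "w \<in> L n" "i \<le> m" for w i
    using that(1) unfolding L_eq
  proof (induction rule: cvec.span_induct_alt)
    case base
    then show ?case using tensor_simps(6)[of "vbasis i" 0 "0 :: nat \<Rightarrow>\<^sub>0 complex"] by (simp add: cvec.span_zero)
  next
    case (step c x y)
    then obtain j where "j \<le> n" "x = vbasis j" by auto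
    then have "vbasis i \<otimes> x \<in> cspan ?T"
      using that(2) by (intro cvec.span_base) (auto simp: tbasis_def)
    then show ?case using step by (simp add: tensor_simps cvec.span_add cvec.span_scale)
  qed
  note left = this
  have "v \<otimes> w \<in> cspan ?T" if "v \<in> L m" "w \<in> L n" for v w
    using that(1) unfolding L_eq
  proof (induction rule: cvec.span_induct_alt)
    case base
    then show ?case using tensor_simps(5)[of 0 "0 :: nat \<Rightarrow>\<^sub>0 complex" w] by (simp add: cvec.span_zero)
  next
    case (step c x y)
    then show ?case using left[OF that(2)] by (auto simp: tensor_simps intro!: cvec.span_add cvec.span_scale)
  qed
  then show "LL m n \<subseteq> cspan ?T"
    unfolding LL_def by (intro cvec.span_minimal) auto
  show "cspan ?T \<subseteq> LL m n"
    unfolding LL_def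
    by (intro cvec.span_mono) (auto simp: tbasis_def L_eq intro!: exI cvec.span_base)
qed

lemma sum_sum_delta:
  fixes m n :: nat
  assumes "i \<le> m" "j \<le> n"
  shows "(\<Sum>i'\<le>m. \<Sum>j'\<le>n. if i' = i \<and> j' = j then g i' j' else 0) = g i j"
proof -
  have "(\<Sum>j'\<le>n. if i' = i \<and> j' = j then g i' j' else 0) = (if i' = i then g i' j else 0)" for i'
    using assms by (cases "i' = i") auto
  then show ?thesis using assms by simp
qed

lemma LL_expand:
  assumes "t \<in> LL m n" shows "t = (\<Sum>i\<le>m. \<Sum>j\<le>n. tcoord i j t *\<^sub>C tbasis i j)"
  using assms unfolding LL_eq
proof (induction rule: cvec.span_induct_alt)
  case base
  then show ?case by (simp add: clinear_zero[OF tcoord_clinear])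
next
  case (step c x y)
  then obtain i' j' where x: "x = tbasis i' j'" and ij: "i' \<le> m" "j' \<le> n" by auto
  have "(\<Sum>i\<le>m. \<Sum>j\<le>n. tcoord i j x *\<^sub>C tbasis i j)
      = (\<Sum>i\<le>m. \<Sum>j\<le>n. if i = i' \<and> j = j' then tbasis i j else 0)"
    unfolding x tcoord_tbasis by (intro sum.cong) (auto simp: scaleC_one)
  also have "\<dots> = x" using ij x by (simp add: sum_sum_delta)
  finally show ?case
    using step.IH by (simp add: clinear_add[OF tcoord_clinear] clinear_scale[OF tcoord_clinear]
       scaleC_add_left sum.distrib scaleC_complex_def flip: scaleC_scaleC cvec.scale_sum_right)
qed

section \<open>The weight space as a string\<close>

definition wbasis :: "nat \<Rightarrow> nat \<Rightarrow> nat \<Rightarrow> (nat \<Rightarrow>\<^sub>0 complex, nat \<Rightarrow>\<^sub>0 complex) tensor" where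
  "wbasis n l k = tbasis (l - n + k) (min l n - k)"

text \<open>In terms of \<open>d = string_len m n l\<close>, \<open>e = |m - l|\<close>, \<open>f = |n - l|\<close>, the triple \<open>(m, n, l)\<close> is
  determined up to the signs of \<open>m - l\<close> and \<open>n - l\<close>, which accounts for the four triples of the
  theorem. The vectors \<open>wbasis n l k\<close> start at the first index \<open>l - n\<close> (truncated) that occurs.\<close>

abbreviation "string_len m n l \<equiv> min m l - (l - n :: nat)"
abbreviation "nat_dist m l \<equiv> (m - l) + (l - m :: nat)"

text \<open>\<open>comult H\<close> is diagonal on \<open>tbasis\<close>, with an eigenvalue that
  determines \<open>i + j\<close>, so coordinates with \<open>i + j \<noteq> l\<close> vanish. In
  the remaining pairs \<open>i\<close> runs from \<open>l - n\<close> to \<open>min m l\<close>, and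
  \<open>k = i - (l - n)\<close> numbers them.\<close>

lemma weight_space_eq:
  assumes l: "l \<le> m + n"
  shows "weight_space (LL_act m n) (LL m n) (of_nat m + of_nat n - 2 * of_nat l)
    = cspan (wbasis n l ` {..string_len m n l})" (is "?W = cspan ?U")
proof
  show "?W \<subseteq> cspan ?U"
  proof
    fix t assume "t \<in> ?W"
    then have t: "t \<in> LL m n" "LL_act m n (comult H) t = (of_nat m + of_nat n - 2 * of_nat l) *\<^sub>C t"
      by (auto simp: weight_space_def)
    have c0: "tcoord i j t = 0" if ij: "i \<le> m" "j \<le> n" "i + j \<noteq> l" for i j
    proof -
      let ?h = "\<lambda>i j. of_nat m + of_nat n - 2 * of_nat (i + j) :: complex"
      have "LL_act m n (comult H) t = (\<Sum>i\<le>m. \<Sum>j\<le>n. (tcoord i j t * ?h i j) *\<^sub>C tbasis i j)"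
        by (subst LL_expand[OF t(1)], unfold clinear_sum[OF LL_act_clinear] clinear_scale[OF LL_act_clinear],
            intro sum.cong) (auto simp: LL_act_comult_H scaleC_scaleC)
      then have "tcoord i j (LL_act m n (comult H) t) =
          (\<Sum>i'\<le>m. \<Sum>j'\<le>n. if i' = i \<and> j' = j then tcoord i' j' t * ?h i' j' else 0)"
        by (simp only: clinear_sum[OF tcoord_clinear] clinear_scale[OF tcoord_clinear])
          (intro sum.cong, auto simp: tcoord_tbasis scaleC_complex_def)
      then have "(of_nat m + of_nat n - 2 * of_nat l) * tcoord i j t = tcoord i j t * ?h i j"
        using ij t(2) by (simp add: sum_sum_delta clinear_scale[OF tcoord_clinear] scaleC_complex_def)
      then have "tcoord i j t = 0 \<or> (of_nat (i + j) :: complex) = of_nat l"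
        by (auto simp: algebra_simps simp del: of_nat_add)
      then show ?thesis using ij(3) unfolding of_nat_eq_iff by blast
    qed
    have "tcoord i j t *\<^sub>C tbasis i j \<in> cspan ?U" if ij: "i \<le> m" "j \<le> n" for i j
    proof (cases "i + j = l")
      case True
      then have "l - n + (i - (l - n)) = i" "min l n - (i - (l - n)) = j" and k: "i - (l - n) \<le> string_len m n l"
        using ij by linarith+
      then have "tbasis i j = wbasis n l (i - (l - n))" by (simp only: wbasis_def)
      with k show ?thesis by (intro cvec.span_scale cvec.span_base) simp
    qed (simp add: c0 ij cvec.span_zero)
    then show "t \<in> cspan ?U"
      by (subst LL_expand[OF t(1)]) (auto intro!: cvec.span_sum)
  qed
  have "csubspace (LL m n)" by (simp add: LL_def)
  then have "csubspace ?W"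
    by (auto simp: cvec.subspace_def weight_space_def clinear_add[OF LL_act_clinear] clinear_scale[OF LL_act_clinear]
      clinear_zero[OF LL_act_clinear] scaleC_add_right scaleC_scaleC mult.commute)
  moreover have "wbasis n l k \<in> ?W" if "k \<le> string_len m n l" for k
  proof -
    have "l - n + k \<le> m" "min l n - k \<le> n" "l - n + k + (min l n - k) = l" using that l by auto
    then show ?thesis
      using LL_act_comult_H[of "l - n + k" m "min l n - k" n]
      by (auto simp: weight_space_def LL_eq wbasis_def simp del: of_nat_add intro!: cvec.span_base)
  qed
  ultimately show "cspan ?U \<subseteq> ?W" by (intro cvec.span_minimal) auto
qed

text \<open>The matrix entries of \<open>hahn_act_tbasis\<close> are rewritten in the string
  parameters. The comparisons of \<open>l\<close> with \<open>m\<close> and \<open>n\<close> resolve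
  the absolute values, and all cases lead to the same formulas.\<close>

lemma hahn_string_wbasis:
  assumes l: "l \<le> m + n"
  shows "hahn_string (hahn_act m n) (wbasis n l) (\<lambda>k. tcoord (l - n + k) (min l n - k))
     (string_len m n l) (nat_dist m l) (nat_dist n l)"
proof
  fix j k :: nat
  show "module_on (hahn_act m n) UNIV" by (rule hahn_act_module)
  show "clinear (tcoord (l - n + k) (min l n - k))" by (rule tcoord_clinear)
  assume k: "k \<le> string_len m n l"
  then have ij: "l - n + k \<le> m" "min l n - k \<le> n" using l by auto
  show "tcoord (l - n + k) (min l n - k) (wbasis n l j) = (if j = k then 1 else 0)" if "j \<le> string_len m n l"
    by (auto simp: wbasis_def tcoord_tbasis)
  have weight: "(of_nat m - 2 * of_nat (l - n + k) - of_nat n + 2 * of_nat (min l n - k)) / 4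
      = string_weight (string_len m n l) (nat_dist m l) (nat_dist n l) k"
    using l k
    by (cases "l \<le> n"; cases "l \<le> m") (auto simp: string_weight_def of_nat_diff field_simps)
  have diag: "(of_nat m * (of_nat m + 2) + of_nat n * (of_nat n + 2)
         + 2 * (of_nat m - 2 * of_nat (l - n + k)) * (of_nat n - 2 * of_nat (min l n - k))) / 4
      = string_diag (string_len m n l) (nat_dist m l) (nat_dist n l) k"
    using l k
    by (cases "l \<le> n"; cases "l \<le> m") (auto simp: string_diag_def of_nat_diff field_simps)
  have lower: "(l - n + k) * (n - (min l n - k)) = k * (k + nat_dist n l)"
    using l k by (cases "l \<le> n") auto
  \<comment> \<open>At \<open>k = 0\<close> the second index on the left is
    \<open>min l n + 1\<close> but \<open>min l n\<close> on the right, so the equation fails there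
    and the zero coefficient takes over.\<close>
  have lower': "(k * (k + nat_dist n l)) = 0 \<or> tbasis (l - n + k - 1) (min l n - k + 1) = wbasis n l (k - 1)"
  proof (cases "k = 0")
    case False
    then have "min l n - k + 1 = min l n - (k - 1)" "l - n + k - 1 = l - n + (k - 1)" using l k by auto
    then show ?thesis by (simp only: wbasis_def simp_thms)
  qed simp
  have upper: "(m - (l - n + k)) * (min l n - k) = (string_len m n l - k) * (string_len m n l + nat_dist m l - k)"
    using l k by (cases "l \<le> n"; cases "l \<le> m") auto
  have upper': "tbasis (l - n + k + 1) (min l n - k - 1) = wbasis n l (k + 1)"
    by (simp add: wbasis_def)
  note act = hahn_act_tbasis[OF ij, unfolded weight diag lower upper upper', folded wbasis_def]
  show "hahn_act m n (pgen gA) (wbasis n l k) = string_weight (string_len m n l) (nat_dist m l) (nat_dist n l) k *\<^sub>C wbasis n l k"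
    by (rule act(1))
  show "hahn_act m n (pgen gB) (wbasis n l k) = of_nat (k * (k + nat_dist n l)) *\<^sub>C wbasis n l (k - 1)
      + string_diag (string_len m n l) (nat_dist m l) (nat_dist n l) k *\<^sub>C wbasis n l k
      + of_nat ((string_len m n l - k) * (string_len m n l + nat_dist m l - k)) *\<^sub>C wbasis n l (k + 1)"
    "hahn_act m n (pgen gC) (wbasis n l k) = of_nat (k * (k + nat_dist n l)) *\<^sub>C wbasis n l (k - 1)
      - of_nat ((string_len m n l - k) * (string_len m n l + nat_dist m l - k)) *\<^sub>C wbasis n l (k + 1)"
    using act(2,3) lower' by (metis cvec.scale_zero_left of_nat_0)+
qed

section \<open>Recovering the triple from the string parameters\<close>

lemma string_parameters_iff:
  assumes "l \<le> m + n"
  shows "string_len m n l = d \<and> nat_dist m l = e \<and> nat_dist n l = f \<longleftrightarrow>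
    (m, n, l) \<in> {(d + e, d + f, d), (d + e + f, d, d + f), (d, d + e + f, d + e), (d + f, d + e, d + e + f)}"
proof
  assume "string_len m n l = d \<and> nat_dist m l = e \<and> nat_dist n l = f"
  then have *: "string_len m n l = d" "nat_dist m l = e" "nat_dist n l = f" by blast+
  let ?Q = "{(d + e, d + f, d), (d + e + f, d, d + f), (d, d + e + f, d + e), (d + f, d + e, d + e + f)}"
  consider "l \<le> m" "l \<le> n" | "l \<le> m" "n \<le> l" | "m \<le> l" "l \<le> n" | "m \<le> l" "n \<le> l" by linarith
  then show "(m, n, l) \<in> ?Q"
  proof cases
    case 1
    then obtain a b where "m = l + a" "n = l + b" by (metis le_Suc_ex)
    with * show ?thesis by simp
  next
    case 2
    then obtain a b where "m = n + b + a" "l = n + b" by (metis le_Suc_ex)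
    with * show ?thesis by simp
  next
    case 3
    then obtain a b where "n = m + a + b" "l = m + a" by (metis le_Suc_ex)
    with * show ?thesis by simp
  next
    case 4
    \<comment> \<open>In this case \<open>m + n - l\<close> is the parameter \<open>d\<close>;
      \<open>l \<le> m + n\<close> makes the subtraction exact.\<close>
    then have "m = (m + n - l) + (l - n)" "n = (m + n - l) + (l - m)" "l = (m + n - l) + (l - n) + (l - m)"
      using assms by linarith+
    then obtain a b c where "m = c + b" "n = c + a" "l = c + b + a" by blast
    with * show ?thesis by simp
  qed
qed (elim insertE emptyE; simp)

text \<open>The four triples form the whole fibre over the parameters of \<open>(m, n, l)\<close>:
  whichever member of the fibre \<open>(m, n, l)\<close> is, the four expressions run through the
  same set.\<close>

lemma string_parameters_eq_iff:
  assumes "l \<le> m + n" "l' \<le> m' + n'"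
  shows "string_len m' n' l' = string_len m n l \<and> nat_dist m' l' = nat_dist m l \<and> nat_dist n' l' = nat_dist n l \<longleftrightarrow>
    (m', n', l') \<in> {(m, n, l), (m + n - l, l, n), (l, m + n - l, m), (n, m, m + n - l)}"
proof -
  define d e f where "d = string_len m n l" "e = nat_dist m l" "f = nat_dist n l"
  then have "(m, n, l) \<in> {(d + e, d + f, d), (d + e + f, d, d + f), (d, d + e + f, d + e), (d + f, d + e, d + e + f)}"
    using string_parameters_iff[OF assms(1), of d e f] by blast
  then consider "m = d + e" "n = d + f" "l = d" | "m = d + e + f" "n = d" "l = d + f"
    | "m = d" "n = d + e + f" "l = d + e" | "m = d + f" "n = d + e" "l = d + e + f"
    unfolding insert_iff prod.inject by blast
  then have "{(m, n, l), (m + n - l, l, n), (l, m + n - l, m), (n, m, m + n - l)} =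
     {(d + e, d + f, d), (d + e + f, d, d + f), (d, d + e + f, d + e), (d + f, d + e, d + e + f)}"
    by cases (auto simp: ac_simps)
  then show ?thesis
    using string_parameters_iff[OF assms(2), of d e f] by (simp only: d_e_f_def)
qed

theorem theorem1p7:
  fixes m n l :: nat
  assumes "l \<le> m + n"
  shows
    "irreducible_module (hahn_act m n)
       (weight_space (LL_act m n) (LL m n) (of_nat m + of_nat n - 2 * of_nat l)) \<and>
     int (cdim (weight_space (LL_act m n) (LL m n) (of_nat m + of_nat n - 2 * of_nat l)))
       = int (min m l) + int (min n l) - int l + 1 \<and>
     (\<forall>m' n' l' :: nat. l' \<le> m' + n' \<longrightarrow>
       (isomorphic_modules
          (hahn_act m' n')
          (weight_space (LL_act m' n') (LL m' n') (of_nat m' + of_nat n' - 2 * of_nat l'))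
          (hahn_act m n)
          (weight_space (LL_act m n) (LL m n) (of_nat m + of_nat n - 2 * of_nat l))
        \<longleftrightarrow> (m', n', l') \<in> {(m, n, l), (m + n - l, l, n), (l, m + n - l, m), (n, m, m + n - l)}))"
proof -
  note S = hahn_string_wbasis
  have W: "weight_space (LL_act m n) (LL m n) (of_nat m + of_nat n - 2 * of_nat l)
      = hahn_string.V (wbasis n l) (string_len m n l)" if "l \<le> m + n" for m n l
    using weight_space_eq[OF that] hahn_string.V_def[OF S[OF that]] by simp
  \<comment> \<open>Here \<open>min n l = l - (l - n)\<close>, and \<open>l \<le> m + n\<close>
    gives \<open>l - n \<le> min m l\<close>, so no subtraction is truncated.\<close>
  have "int (string_len m n l) + 1 = int (min m l) + int (min n l) - int l + 1"
    using assms by auto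
  then show ?thesis
    using hahn_string.irreducible_V[OF S[OF assms]] hahn_string.cdim_V[OF S[OF assms]]
      hahn_string_isomorphic_iff[OF S S[OF assms]] string_parameters_eq_iff[OF assms]
    by (simp add: W assms)
qed

end
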